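(* Let $G$ be a simple compact Lie group. If $C$ and $D$ are noncentral conjugacy classes of $G$, then $CD$ consists of infinitely many conjugacy classes.
   Context: $CD=\{xy\mid x\in C,\,y\in D\}$. Lie groups are real Lie groups. *)

theory Defs
  imports "HOL-Analysis.Analysis" "HOL-Algebra.Coset"
begin

section \<open>Smooth manifolds\<close>

text \<open>
  Used for open \<open>S\<close> only. In finite dimension the derivative is a \<open>C\<^sup>k\<close> map iff all
  its directional values \<open>\<lambda>x. f' x v\<close> are.
\<close>

primrec Ck_on :: "nat \<Rightarrow> ('e::euclidean_space \<Rightarrow> 'f::euclidean_space) \<Rightarrow> 'e set \<Rightarrow> bool" where
  "Ck_on 0 f S \<longleftrightarrow> continuous_on S f"
| "Ck_on (Suc k) f S \<longleftrightarrow>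
     (\<exists>f'. (\<forall>x\<in>S. (f has_derivative f' x) (at x)) \<and> (\<forall>v. Ck_on k (\<lambda>x. f' x v) S))"

definition smooth_on :: "('e::euclidean_space \<Rightarrow> 'f::euclidean_space) \<Rightarrow> 'e set \<Rightarrow> bool" where
  "smooth_on f S \<longleftrightarrow> (\<forall>k. Ck_on k f S)"

text \<open>
  A chart is a pair \<open>(U, \<phi>)\<close>; only the restriction of \<open>\<phi>\<close> to \<open>U\<close> is relevant, and the
  inverse of that restriction is \<open>inv_into U \<phi>\<close>.
\<close>

type_synonym ('a, 'e) chart = "'a set \<times> ('a \<Rightarrow> 'e)"

definition is_chart :: "'a topology \<Rightarrow> ('a, 'e::euclidean_space) chart \<Rightarrow> bool" where
  "is_chart T = (\<lambda>(U, \<phi>). openin T U \<and> open (\<phi> ` U) \<and>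
     homeomorphic_map (subtopology T U) (top_of_set (\<phi> ` U)) \<phi>)"

definition second_countable_space :: "'a topology \<Rightarrow> bool" where
  "second_countable_space T \<longleftrightarrow>
     (\<exists>\<B>. countable \<B> \<and> openin T = arbitrary union_of (\<lambda>U. U \<in> \<B>))"

text \<open>
  The atlas need not be maximal; it determines the smooth structure. The dimension is
  \<open>DIM('e)\<close>, hence positive. Discrete (zero-dimensional) groups are thereby left out,
  which is harmless for the connected nontrivial groups considered below.
\<close>

locale smooth_manifold =
  fixes T :: "'a topology" and A :: "('a, 'e::euclidean_space) chart set"
  assumes Hausdorff: "Hausdorff_space T"
    and second_countable: "second_countable_space T"
    and charts: "\<And>c. c \<in> A \<Longrightarrow> is_chart T c"
    and cover: "(\<Union>(U, \<phi>)\<in>A. U) = topspace T"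
    and compatible: "\<And>U \<phi> V \<psi>. (U, \<phi>) \<in> A \<Longrightarrow> (V, \<psi>) \<in> A \<Longrightarrow>
          smooth_on (\<psi> \<circ> inv_into U \<phi>) (\<phi> ` (U \<inter> V))"

definition prod_atlas ::
  "('a, 'e) chart set \<Rightarrow> ('b, 'f) chart set \<Rightarrow> ('a \<times> 'b, 'e \<times> 'f) chart set" where
  "prod_atlas A B = {(U \<times> V, map_prod \<phi> \<psi>) | U \<phi> V \<psi>. (U, \<phi>) \<in> A \<and> (V, \<psi>) \<in> B}"

definition smooth_map ::
  "'a topology \<Rightarrow> ('a, 'e::euclidean_space) chart set \<Rightarrow>
   'b topology \<Rightarrow> ('b, 'f::euclidean_space) chart set \<Rightarrow> ('a \<Rightarrow> 'b) \<Rightarrow> bool" where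
  "smooth_map T A T' B f \<longleftrightarrow> continuous_map T T' f \<and>
     (\<forall>(U, \<phi>)\<in>A. \<forall>(V, \<psi>)\<in>B. smooth_on (\<psi> \<circ> f \<circ> inv_into U \<phi>) (\<phi> ` {x \<in> U. f x \<in> V}))"


section \<open>Lie groups\<close>

locale lie_group = group G + smooth_manifold T A
  for G :: "('a, 'b) monoid_scheme" (structure)
    and T :: "'a topology" and A :: "('a, 'e::euclidean_space) chart set" +
  assumes topspace_carrier: "topspace T = carrier G"
    and smooth_mult: "smooth_map (prod_topology T T) (prod_atlas A A) T A (\<lambda>(x, y). x \<otimes> y)"
    and smooth_inv: "smooth_map T A T A (\<lambda>x. inv x)"

text \<open>
  Simplicity of Lie groups is weaker than simplicity of the abstract group: discrete
  normal subgroups, such as a finite centre, are allowed.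
\<close>

locale simple_lie_group = lie_group +
  assumes connected: "connected_space T"
    and nonabelian: "\<not> comm_group G"
    and no_connected_normal:
      "\<And>H. H \<lhd> G \<Longrightarrow> closedin T H \<Longrightarrow> connectedin T H \<Longrightarrow> H = {\<one>} \<or> H = carrier G"


section \<open>Conjugacy classes\<close>

definition conjugacy_class :: "('a, 'b) monoid_scheme \<Rightarrow> 'a \<Rightarrow> 'a set" where
  "conjugacy_class G x = {g \<otimes>\<^bsub>G\<^esub> x \<otimes>\<^bsub>G\<^esub> inv\<^bsub>G\<^esub> g | g. g \<in> carrier G}"

definition conjugacy_classes :: "('a, 'b) monoid_scheme \<Rightarrow> 'a set set" where
  "conjugacy_classes G = conjugacy_class G ` carrier G"

definition group_center :: "('a, 'b) monoid_scheme \<Rightarrow> 'a set" where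
  "group_center G = {z \<in> carrier G. \<forall>g\<in>carrier G. g \<otimes>\<^bsub>G\<^esub> z = z \<otimes>\<^bsub>G\<^esub> g}"

end

(*
  If CD is a finite union of conjugacy classes, then by connectedness it is a single class.
  The compact group K = Ad G is orthogonal for a suitable inner product, and then
  phi(A) = n - tr A = |A - 1|^2 / 2 is a class function on K. Take c in C and d in D, identified
  with their images in K, and choose A_1, ..., A_N in K with product cd that minimise the sum of
  the phi(A_i); as G is a connected Lie group, for large N the A_i are as close to 1 as we like.
  For Q in K the element (Q c Q^-1 c^-1) cd also lies in CD, hence is conjugate to cd and has the
  same minimum. Inserting the factor Q c Q^-1 c^-1 into the product at place i and letting Q
  tend to 1 gives tr (B A) = tr (B c^-1 A c) for all tangent vectors B, where A is A_i conjugated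
  by the partial product. Elements close to 1 are determined by these traces, so c commutes
  with A. Hence c commutes with all A_i, with their product cd, and with d.

  The kernel of Ad is the centre. The closed subgroup generated by the quotients of elements
  of D is connected, normal and nontrivial, so it is G and all commutators [c, g] are central.
  Then g |-> [c, g] is a homomorphism whose image is closed, connected and normal; it is not G
  as G is not abelian, so it is trivial and c is central.
*)

theory Submission
  imports Defs "HOL-Algebra.Generated_Groups"
begin

section \<open>Compact groups of orthogonal maps\<close>

text \<open>Invariance of the functional under conjugation links classes to commutation: a
  factorization of a conjugate of cd can be conjugated back into one of cd at equal cost, so Q c
  Q^-1 d is never cheaper than cd. Only one factor has to change in the comparison, because a factor
  R in front of the whole product is carried to place i by conjugating it with the partial product.
  Squared distances are essential: a path cut into N steps costs N terms of order 1/N^2, so the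
  minimum falls below any threshold, and as the terms are nonnegative every single A_i is then close
  to 1. The first-order condition is at first an inequality; it becomes an equality because tangent
  vectors come with their negatives. It can be read backwards only near 1, hence the need for many
  small factors. Commuting in Ad G makes only the commutators central in G, which is why simplicity
  is applied twice. The first application uses commutation for all pairs in C x D, and passes from D
  to quotients because these form a connected set through 1.\<close>

definition tr :: "('e::euclidean_space \<Rightarrow>\<^sub>L 'e) \<Rightarrow> real" where
  "tr A = (\<Sum>b\<in>Basis. A b \<bullet> b)"

lemma null_of_norm_le:
  fixes f :: "'a \<Rightarrow> 'b::real_normed_vector"
  assumes "\<And>n. norm (f n) \<le> g n" "(g \<longlongrightarrow> 0) F" shows "(f \<longlongrightarrow> 0) F"
  by (rule Lim_null_comparison[of f g]) (simp_all add: assms)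

lemma bounded_linear_tr: "bounded_linear (tr :: ('e::euclidean_space \<Rightarrow>\<^sub>L 'e) \<Rightarrow> real)"
  unfolding tr_def
  by (intro bounded_linear_sum bounded_linear_inner_left_comp
      bounded_linear_apply_blinfun bounded_linear_ident)

lemmas tr_linear = bounded_linear_tr[THEN bounded_linear.linear]

lemma tr_compose_commute:
  fixes A B :: "'e::euclidean_space \<Rightarrow>\<^sub>L 'e"
  shows "tr (A o\<^sub>L B) = tr (B o\<^sub>L A)"
proof -
  have *: "A (B b) \<bullet> b = (\<Sum>c\<in>Basis. (B b \<bullet> c) * (A c \<bullet> b))" for A B :: "'e \<Rightarrow>\<^sub>L 'e" and b
  proof -
    have "A (B b) = A (\<Sum>c\<in>Basis. (B b \<bullet> c) *\<^sub>R c)"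
      by (simp add: euclidean_representation)
    also have "\<dots> = (\<Sum>c\<in>Basis. (B b \<bullet> c) *\<^sub>R A c)"
      by (simp add: blinfun.sum_right blinfun.scaleR_right)
    finally show ?thesis by (simp add: inner_sum_left)
  qed
  show ?thesis
    unfolding tr_def blinfun_apply_blinfun_compose *
    by (subst sum.swap) (simp add: mult.commute)
qed

lemma blinfun_compose_assoc: "(A o\<^sub>L B) o\<^sub>L C = A o\<^sub>L (B o\<^sub>L C)"
  by (rule blinfun_eqI) simp

lemma blinfun_compose_id [simp]: "A o\<^sub>L id_blinfun = A" "id_blinfun o\<^sub>L A = A"
  by (rule blinfun_eqI, simp)+

text \<open>The inverse is a parameter so that a group obtained as an image can bring the inverse
  along from its source; only the values of \<open>J\<close> on \<open>K\<close> matter.\<close>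

locale compact_orthogonal_group =
  fixes K :: "('e::euclidean_space \<Rightarrow>\<^sub>L 'e) set" and J :: "('e \<Rightarrow>\<^sub>L 'e) \<Rightarrow> 'e \<Rightarrow>\<^sub>L 'e"
  assumes compact: "compact K"
    and id_mem: "id_blinfun \<in> K"
    and comp_mem: "\<And>A B. A \<in> K \<Longrightarrow> B \<in> K \<Longrightarrow> A o\<^sub>L B \<in> K"
    and inv_mem: "\<And>A. A \<in> K \<Longrightarrow> J A \<in> K"
    and inv_left: "\<And>A. A \<in> K \<Longrightarrow> J A o\<^sub>L A = id_blinfun"
    and inv_right: "\<And>A. A \<in> K \<Longrightarrow> A o\<^sub>L J A = id_blinfun"
    and norm_apply: "\<And>A v. A \<in> K \<Longrightarrow> norm (A v) = norm v"
begin

lemma inv_left_apply [simp]: "A \<in> K \<Longrightarrow> J A (A v) = v"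
  using inv_left[of A] by (metis blinfun_apply_blinfun_compose blinfun_apply_id_blinfun)

lemma inv_right_apply [simp]: "A \<in> K \<Longrightarrow> A (J A v) = v"
  using inv_right[of A] by (metis blinfun_apply_blinfun_compose blinfun_apply_id_blinfun)

lemma inv_inv: "A \<in> K \<Longrightarrow> J (J A) = A"
  by (rule blinfun_eqI) (metis inv_left_apply inv_right_apply inv_mem)

lemma norm_le_1: "A \<in> K \<Longrightarrow> norm A \<le> 1"
  by (rule norm_blinfun_bound) (auto simp: norm_apply)

lemma inner_apply: "A \<in> K \<Longrightarrow> A x \<bullet> A y = x \<bullet> y"
proof -
  assume A: "A \<in> K"
  have "orthogonal_transformation (blinfun_apply A)"
    unfolding orthogonal_transformation
    using A norm_apply by (auto intro: bounded_linear.linear blinfun.bounded_linear_right)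
  then show ?thesis by (simp add: orthogonal_transformation_def)
qed

text \<open>The function phi of the overview. The trace makes invariance under conjugation visible;
  \<open>defect_eq\<close> identifies it with half the squared Hilbert-Schmidt distance to the
  identity.\<close>

definition defect :: "('e \<Rightarrow>\<^sub>L 'e) \<Rightarrow> real" where
  "defect A = real DIM('e) - tr A"

lemma defect_eq:
  assumes "A \<in> K" shows "defect A = (\<Sum>b\<in>Basis. (norm (A b - b))\<^sup>2) / 2"
proof -
  have "(norm (A b - b))\<^sup>2 = 2 - 2 * (A b \<bullet> b)" if "b \<in> Basis" for b
    using that inner_apply[OF assms, of b b]
    by (simp add: power2_norm_eq_inner inner_diff inner_commute)
  then show ?thesis
    by (simp add: defect_def tr_def sum_subtractf sum_distrib_left[symmetric])
qed

lemma defect_nonneg: "A \<in> K \<Longrightarrow> 0 \<le> defect A"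
  by (simp add: defect_eq sum_nonneg)

lemma defect_le:
  assumes "A \<in> K" shows "defect A \<le> real DIM('e) * (norm (A - id_blinfun))\<^sup>2"
proof -
  have "(norm (A b - b))\<^sup>2 \<le> (norm (A - id_blinfun))\<^sup>2" if "b \<in> Basis" for b
    using norm_blinfun[of "A - id_blinfun" b] that
    by (intro power_mono) (auto simp: blinfun.diff_left)
  then have "(\<Sum>b\<in>Basis. (norm (A b - b))\<^sup>2) \<le> (\<Sum>b\<in>(Basis::'e set). (norm (A - id_blinfun))\<^sup>2)"
    by (rule sum_mono)
  moreover have "0 \<le> (\<Sum>b\<in>Basis. (norm (A b - b))\<^sup>2)" by (simp add: sum_nonneg)
  ultimately show ?thesis
    using defect_eq[OF assms] by simp
qed

text \<open>Together with \<open>defect_le\<close>: small defect and closeness to the identity in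
  operator norm amount to the same, up to a square and constants depending on the dimension.\<close>

lemma norm_diff_id_le:
  assumes "A \<in> K" shows "norm (A - id_blinfun) \<le> real DIM('e) * sqrt (2 * defect A)"
proof -
  have "norm (A b - b) \<le> sqrt (2 * defect A)" if "b \<in> Basis" for b
  proof (rule real_le_rsqrt)
    show "(norm (A b - b))\<^sup>2 \<le> 2 * defect A"
      unfolding defect_eq[OF assms] using that
      by (simp add: member_le_sum[where f = "\<lambda>b. (norm (A b - b))\<^sup>2"])
  qed
  then have "(\<Sum>b\<in>Basis. norm (A b - b)) \<le> (\<Sum>b\<in>(Basis::'e set). sqrt (2 * defect A))"
    by (rule sum_mono)
  moreover have "norm (A - id_blinfun) \<le> (\<Sum>b\<in>Basis. norm (A b - b))"
    using norm_blinfun_euclidean_le[of "A - id_blinfun"] by (simp add: blinfun.diff_left)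
  ultimately show ?thesis by simp
qed

lemma defect_conj: "A \<in> K \<Longrightarrow> B \<in> K \<Longrightarrow> defect (B o\<^sub>L (A o\<^sub>L J B)) = defect A"
  unfolding defect_def
  by (subst tr_compose_commute) (simp add: blinfun_compose_assoc inv_left)

text \<open>The tangent cone of \<open>K\<close> at the identity. Sequences make it meaningful for
  any compact group of operators, and limits of difference quotients are what compactness arguments
  produce.\<close>

definition tangent :: "('e \<Rightarrow>\<^sub>L 'e) \<Rightarrow> bool" where
  "tangent B \<longleftrightarrow> (\<exists>Q t. (\<forall>n. Q n \<in> K) \<and> (\<forall>n. 0 < t n) \<and> t \<longlonglongrightarrow> 0 \<and>
     (\<lambda>n::nat. (Q n - id_blinfun) /\<^sub>R t n) \<longlonglongrightarrow> B)"

lemma tangentE: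
  assumes "tangent B"
  obtains Q t where "\<And>n. Q n \<in> K" "\<And>n. 0 < t n" "t \<longlonglongrightarrow> 0"
    "(\<lambda>n::nat. (Q n - id_blinfun) /\<^sub>R t n) \<longlonglongrightarrow> B"
proof -
  from assms obtain Q t where "(\<forall>n. Q n \<in> K) \<and> (\<forall>n. 0 < t n) \<and> t \<longlonglongrightarrow> 0 \<and>
     (\<lambda>n::nat. (Q n - id_blinfun) /\<^sub>R t n) \<longlonglongrightarrow> B"
    unfolding tangent_def by (elim exE) (rule that)
  then show ?thesis by (intro that[of Q t]) simp_all
qed

lemma tangentI:
  assumes "\<And>n. Q n \<in> K" "\<And>n. 0 < t n" "t \<longlonglongrightarrow> 0"
    "(\<lambda>n::nat. (Q n - id_blinfun) /\<^sub>R t n) \<longlonglongrightarrow> B"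
  shows "tangent B"
  unfolding tangent_def using assms by (intro exI[of _ Q] exI[of _ t]) simp

lemma tangent_limit:
  assumes "\<And>n. 0 < t n" "t \<longlonglongrightarrow> 0" "(\<lambda>n::nat. (Q n - id_blinfun) /\<^sub>R t n) \<longlonglongrightarrow> B"
  shows "Q \<longlonglongrightarrow> id_blinfun"
proof -
  have "(\<lambda>n. t n *\<^sub>R ((Q n - id_blinfun) /\<^sub>R t n) + id_blinfun) \<longlonglongrightarrow> 0 *\<^sub>R B + id_blinfun"
    by (intro tendsto_intros assms)
  moreover have "t n *\<^sub>R ((Q n - id_blinfun) /\<^sub>R t n) + id_blinfun = Q n" for n
    using assms(1)[of n] by simp
  ultimately show ?thesis by simp
qed

text \<open>Continuity of \<open>J\<close> is not among the assumptions; it comes from J Q - 1 = J Q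
  (1 - Q), where \<open>J Q\<close> has norm at most 1.\<close>

lemma inv_limit:
  assumes "\<And>n. Q n \<in> K" "(Q \<longlongrightarrow> id_blinfun) F" shows "((\<lambda>n. J (Q n)) \<longlongrightarrow> id_blinfun) F"
proof -
  have "norm (J (Q n) - id_blinfun) \<le> norm (Q n - id_blinfun)" for n
  proof -
    have "J (Q n) - id_blinfun = J (Q n) o\<^sub>L (id_blinfun - Q n)"
      using assms(1)[of n] by (intro blinfun_eqI) (simp add: blinfun.diff_left blinfun.diff_right)
    then have "norm (J (Q n) - id_blinfun) \<le> norm (J (Q n)) * norm (id_blinfun - Q n)"
      by (metis norm_blinfun_compose)
    also have "\<dots> \<le> 1 * norm (id_blinfun - Q n)"
      by (intro mult_right_mono norm_le_1 inv_mem assms) auto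
    finally show ?thesis by (simp add: norm_minus_commute)
  qed
  moreover have "((\<lambda>n. norm (Q n - id_blinfun)) \<longlongrightarrow> 0) F"
    using assms(2) by (simp add: LIM_zero tendsto_norm_zero)
  ultimately have "((\<lambda>n. J (Q n) - id_blinfun) \<longlongrightarrow> 0) F"
    by (rule null_of_norm_le)
  then show ?thesis by (simp add: LIM_zero_iff)
qed

lemma tangent_inv_limit:
  assumes "\<And>n. Q n \<in> K" "\<And>n. 0 < t n" "t \<longlonglongrightarrow> 0" "(\<lambda>n::nat. (Q n - id_blinfun) /\<^sub>R t n) \<longlonglongrightarrow> B"
  shows "(\<lambda>n. (J (Q n) - id_blinfun) /\<^sub>R t n) \<longlonglongrightarrow> - B"
proof -
  have "(\<lambda>n. - (J (Q n) o\<^sub>L ((Q n - id_blinfun) /\<^sub>R t n))) \<longlonglongrightarrow> - (id_blinfun o\<^sub>L B)"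
    by (intro tendsto_intros assms inv_limit tangent_limit[OF assms(2-4)])
  moreover have "- (J (Q n) o\<^sub>L ((Q n - id_blinfun) /\<^sub>R t n)) = (J (Q n) - id_blinfun) /\<^sub>R t n" for n
    using assms(1)[of n]
    by (intro blinfun_eqI) (simp add: blinfun.bilinear_simps algebra_simps)
  moreover have "id_blinfun o\<^sub>L B = B" by (intro blinfun_eqI) simp
  ultimately show ?thesis by simp
qed

text \<open>This is what later turns the inequality given by minimality into an equality.\<close>

lemma tangent_minus:
  assumes "tangent B" shows "tangent (- B)"
proof -
  obtain Q t where "\<And>n. Q n \<in> K" "\<And>n. 0 < t n" "t \<longlonglongrightarrow> 0"
      "(\<lambda>n::nat. (Q n - id_blinfun) /\<^sub>R t n) \<longlonglongrightarrow> B"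
    using tangentE[OF assms(1)] by metis
  then show ?thesis
    using tangent_inv_limit[of Q t B] inv_mem by (intro tangentI[of "\<lambda>n. J (Q n)" t]) simp_all
qed

text \<open>The product rule for Q x . Q y, which is constantly x . y because the approximating
  \<open>Q n\<close> are orthogonal.\<close>

lemma tangent_skew:
  assumes "tangent B" shows "B x \<bullet> y = - (x \<bullet> B y)"
proof -
  obtain Q t where Q: "\<And>n. Q n \<in> K" "\<And>n. 0 < t n" "t \<longlonglongrightarrow> 0"
      "(\<lambda>n::nat. (Q n - id_blinfun) /\<^sub>R t n) \<longlonglongrightarrow> B"
    using tangentE[OF assms(1)] by metis
  define X where "X n = (Q n - id_blinfun) /\<^sub>R t n" for n
  have "(\<lambda>n. X n x \<bullet> Q n y + x \<bullet> X n y) \<longlonglongrightarrow> B x \<bullet> id_blinfun y + x \<bullet> B y"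
    unfolding X_def by (intro tendsto_intros Q(4) tangent_limit[OF Q(2-4)])
  moreover have "X n x \<bullet> Q n y + x \<bullet> X n y = 0" for n
    using Q(2)[of n] inner_apply[OF Q(1)[of n], of x y]
    by (simp add: X_def blinfun.bilinear_simps inner_diff field_simps)
  ultimately show ?thesis
    by (simp add: LIMSEQ_const_iff)
qed

lemma tr_tangent_square:
  assumes "tangent B" "tr (B o\<^sub>L B) = 0" shows "B = 0"
proof -
  have "tr (B o\<^sub>L B) = - (\<Sum>b\<in>Basis. B b \<bullet> B b)"
    by (simp add: tr_def tangent_skew[OF assms(1), of "B _"] sum_negf)
  then have "\<forall>b\<in>Basis. B b \<bullet> B b = 0"
    using assms(2) by (subst sum_nonneg_eq_0_iff[symmetric]) auto
  then show ?thesis by (intro blinfun_euclidean_eqI) auto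
qed

lemma limit_id_of_defect:
  assumes "\<And>n. A n \<in> K" "\<And>n. defect (A n) < inverse (real (Suc n))"
  shows "A \<longlonglongrightarrow> id_blinfun"
proof -
  have "(\<lambda>n. sqrt (2 * inverse (real (Suc n)))) \<longlonglongrightarrow> sqrt (2 * 0)"
    by (intro tendsto_intros LIMSEQ_inverse_real_of_nat)
  then have "(\<lambda>n. real DIM('e) * sqrt (2 * inverse (real (Suc n)))) \<longlonglongrightarrow> 0"
    by (intro tendsto_mult_right_zero) simp
  moreover have "norm (A n - id_blinfun) \<le> real DIM('e) * sqrt (2 * inverse (real (Suc n)))" for n
    using norm_diff_id_le[OF assms(1)[of n]] assms(2)[of n]
    by (elim order_trans) (auto intro!: mult_left_mono)
  ultimately have "(\<lambda>n. A n - id_blinfun) \<longlonglongrightarrow> 0"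
    by (rule null_of_norm_le[rotated])
  then show ?thesis by (simp add: LIM_zero_iff)
qed

text \<open>
  Two different elements differ, after rescaling, almost by a tangent vector \<open>B\<close>, and
  the trace form is negative definite on tangent vectors because these are skew.
\<close>

lemma locally_determined_by_tangent_traces:
  "\<exists>\<delta>>0. \<forall>A\<in>K. \<forall>B\<in>K. defect A < \<delta> \<longrightarrow> defect B < \<delta> \<longrightarrow>
     (\<forall>X. tangent X \<longrightarrow> tr (X o\<^sub>L A) = tr (X o\<^sub>L B)) \<longrightarrow> A = B"
proof (rule ccontr)
  assume "\<not> ?thesis"
  then have "\<exists>A B. A \<in> K \<and> B \<in> K \<and> defect A < inverse (real (Suc n)) \<and>
      defect B < inverse (real (Suc n)) \<and>
      (\<forall>X. tangent X \<longrightarrow> tr (X o\<^sub>L A) = tr (X o\<^sub>L B)) \<and> A \<noteq> B" for n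
    by (metis inverse_positive_iff_positive of_nat_0_less_iff zero_less_Suc)
  then obtain A B where AB: "\<And>n. A n \<in> K" "\<And>n. B n \<in> K"
      "\<And>n. defect (A n) < inverse (real (Suc n))" "\<And>n. defect (B n) < inverse (real (Suc n))"
      "\<And>n X. tangent X \<Longrightarrow> tr (X o\<^sub>L A n) = tr (X o\<^sub>L B n)" "\<And>n. A n \<noteq> B n"
    by metis
  have A: "A \<longlonglongrightarrow> id_blinfun" and B: "B \<longlonglongrightarrow> id_blinfun"
    using AB limit_id_of_defect by blast+
  define Q where "Q n = J (B n) o\<^sub>L A n" for n
  \<comment> \<open>This scale puts the difference quotients on the unit sphere, so that a
    subsequence has a nonzero limit, which is tangent because \<open>t\<close> tends to 0.\<close>
  define t where "t n = norm (Q n - id_blinfun)" for n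
  define X where "X n = (Q n - id_blinfun) /\<^sub>R t n" for n
  have QK: "Q n \<in> K" for n
    unfolding Q_def by (intro comp_mem inv_mem AB)
  have "(\<lambda>n. J (B n) o\<^sub>L A n) \<longlonglongrightarrow> (id_blinfun o\<^sub>L id_blinfun)"
    by (intro tendsto_intros inv_limit A B AB)
  then have Q: "Q \<longlonglongrightarrow> id_blinfun" by (simp add: Q_def[abs_def])
  have BQ: "B n o\<^sub>L Q n = A n" for n
    unfolding Q_def using AB(2) by (intro blinfun_eqI) simp
  have tpos: "0 < t n" for n
  proof -
    have "Q n \<noteq> id_blinfun"
      using BQ[of n] AB(6)[of n] by (metis blinfun_apply_blinfun_compose blinfun_apply_id_blinfun blinfun_eqI)
    then show ?thesis by (simp add: t_def)
  qed
  have t0: "t \<longlonglongrightarrow> 0"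
    unfolding t_def using Q by (simp add: LIM_zero tendsto_norm_zero)
  have "X n \<in> sphere 0 1" for n
    using tpos[of n] by (simp add: X_def t_def)
  moreover have "compact (sphere (0::'e \<Rightarrow>\<^sub>L 'e) 1)"
  proof -
    have "sphere (0::'e \<Rightarrow>\<^sub>L 'e) 1 = {Y. norm Y = 1}" by auto
    moreover have "closed {Y :: 'e \<Rightarrow>\<^sub>L 'e. norm Y = 1}"
      by (intro closed_Collect_eq continuous_intros)
    moreover have "bounded {Y :: 'e \<Rightarrow>\<^sub>L 'e. norm Y = 1}"
      unfolding bounded_iff by (intro exI[of _ 1]) simp
    ultimately show ?thesis by (simp add: compact_eq_bounded_closed)
  qed
  ultimately obtain Y r where Y: "Y \<in> sphere 0 1" and r: "strict_mono (r::nat\<Rightarrow>nat)"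
      and lim: "(X \<circ> r) \<longlonglongrightarrow> Y"
    using seq_compactE[of "sphere 0 1" X] by (metis compact_imp_seq_compact)
  have tang: "tangent Y"
    using QK tpos lim LIMSEQ_subseq_LIMSEQ[OF t0 r]
    by (intro tangentI[of "Q \<circ> r" "t \<circ> r"]) (simp_all add: o_def X_def)
  \<comment> \<open>The traces are tested against the limit \<open>Y\<close> itself: B X is the
    rescaled difference of A and B, so its trace against \<open>Y\<close> vanishes for every n, and
    in the limit it becomes the trace of Y Y.\<close>
  have "(\<lambda>n. tr (Y o\<^sub>L (B (r n) o\<^sub>L X (r n)))) \<longlonglongrightarrow> tr (Y o\<^sub>L (id_blinfun o\<^sub>L Y))"
    using lim LIMSEQ_subseq_LIMSEQ[OF B r]
    by (intro bounded_linear.tendsto[OF bounded_linear_tr] tendsto_intros) (auto simp: o_def)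
  moreover have "tr (Y o\<^sub>L (B n o\<^sub>L X n)) = 0" for n
  proof -
    have "Y o\<^sub>L (B n o\<^sub>L X n) = inverse (t n) *\<^sub>R ((Y o\<^sub>L A n) - (Y o\<^sub>L B n))"
      unfolding X_def BQ[symmetric]
      by (intro blinfun_eqI) (simp add: blinfun.bilinear_simps)
    then show ?thesis
      using AB(5)[OF tang, of n] by (simp add: linear_cmul[OF tr_linear] linear_diff[OF tr_linear])
  qed
  moreover have "Y o\<^sub>L (id_blinfun o\<^sub>L Y) = Y o\<^sub>L Y" by (intro blinfun_eqI) simp
  ultimately have "tr (Y o\<^sub>L Y) = 0" by (simp add: LIMSEQ_const_iff)
  from tr_tangent_square[OF tang this] Y show False by simp
qed

end

section \<open>Factorizations in the group and their total defect\<close>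

primrec comp_upto :: "(nat \<Rightarrow> 'e \<Rightarrow>\<^sub>L 'e) \<Rightarrow> nat \<Rightarrow> ('e::euclidean_space \<Rightarrow>\<^sub>L 'e)" where
  "comp_upto f 0 = id_blinfun"
| "comp_upto f (Suc n) = comp_upto f n o\<^sub>L f n"

lemma comp_upto_cong: "(\<And>i. i < n \<Longrightarrow> f i = g i) \<Longrightarrow> comp_upto f n = comp_upto g n"
  by (induction n) auto

lemma comp_upto_add: "comp_upto f (m + n) = comp_upto f m o\<^sub>L comp_upto (\<lambda>i. f (m + i)) n"
  by (induction n) (auto simp: blinfun_compose_assoc)

lemma continuous_on_comp_upto:
  "continuous_on UNIV (\<lambda>f :: nat \<Rightarrow> ('e::euclidean_space \<Rightarrow>\<^sub>L 'e). comp_upto f n)"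
proof (induction n)
  case (Suc n)
  have "continuous_on UNIV (\<lambda>f :: nat \<Rightarrow> ('e \<Rightarrow>\<^sub>L 'e). comp_upto f n o\<^sub>L f n)"
    by (intro continuous_intros Suc continuous_on_product_coordinates)
  then show ?case by simp
qed simp

text \<open>Tychonoff. Factorizations are functions on all of \<open>nat\<close>, of which
  \<open>comp_upto\<close> reads an initial segment, so the candidates live in a full product of
  copies of \<open>K\<close>.\<close>

lemma compact_PiE_UNIV:
  fixes S :: "'i \<Rightarrow> 'a::topological_space set"
  assumes "\<And>i. compact (S i)" shows "compact {f. \<forall>i. f i \<in> S i}"
proof -
  have "compactin (product_topology (\<lambda>i. euclidean) UNIV) (PiE UNIV S)"
    using assms by (simp add: compactin_PiE compactin_euclidean_iff)
  then show ?thesis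
    by (simp add: euclidean_product_topology compactin_euclidean_iff PiE_UNIV_domain)
       (simp add: Pi_def)
qed

context compact_orthogonal_group
begin

lemma comp_upto_mem: "(\<And>i. f i \<in> K) \<Longrightarrow> comp_upto f n \<in> K"
  by (induction n) (auto intro: id_mem comp_mem)

lemma comp_upto_conj:
  assumes "B \<in> K"
  shows "comp_upto (\<lambda>i. B o\<^sub>L (f i o\<^sub>L J B)) n = B o\<^sub>L (comp_upto f n o\<^sub>L J B)"
proof (induction n)
  case 0
  then show ?case using assms by (simp add: inv_right)
next
  case (Suc n)
  then show ?case using assms by (intro blinfun_eqI) simp
qed

text \<open>With p the product of the first i factors, the new factor is p^-1 R p f_i, and the
  preceding p turns it into R p f_i. A left factor of the whole product is thus absorbed at one
  place.\<close>

lemma comp_upto_update: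
  assumes "\<And>i. f i \<in> K" "i < n"
  shows "comp_upto (f(i := J (comp_upto f i) o\<^sub>L (R o\<^sub>L (comp_upto f i o\<^sub>L f i)))) n = R o\<^sub>L comp_upto f n"
  using assms(2)
proof (induction n)
  case (Suc n)
  show ?case
  proof (cases "i = n")
    case True
    have "comp_upto (f(i := X)) i = comp_upto f i" for X
      by (rule comp_upto_cong) auto
    then show ?thesis
      using True comp_upto_mem[of f i, OF assms(1)]
      by (intro blinfun_eqI) (simp del: fun_upd_apply add: fun_upd_same)
  next
    case False
    then show ?thesis using Suc by (simp add: blinfun_compose_assoc)
  qed
qed simp

text \<open>For fixed \<open>N\<close> the product depends continuously on the factors, so the
  candidates form a closed subset of a compact space, where the continuous total defect attains its
  minimum.\<close>

lemma ex_min_factorization: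
  assumes "\<And>i. f0 i \<in> K" "comp_upto f0 N = x"
  obtains f where "\<And>i. f i \<in> K" "comp_upto f N = x"
    "\<And>g. (\<And>i. g i \<in> K) \<Longrightarrow> comp_upto g N = x \<Longrightarrow> (\<Sum>i<N. defect (f i)) \<le> (\<Sum>i<N. defect (g i))"
proof -
  define M where "M = {f. \<forall>i. f i \<in> K} \<inter> {f. comp_upto f N = x}"
  have "compact M"
    unfolding M_def
    by (intro compact_Int_closed compact_PiE_UNIV compact closed_Collect_eq
        continuous_on_comp_upto continuous_on_const)
  moreover have "f0 \<in> M" using assms by (simp add: M_def)
  moreover have "continuous_on M (\<lambda>f. \<Sum>i<N. defect (f i))"
    unfolding defect_def
    by (intro continuous_intros bounded_linear.continuous_on[OF bounded_linear_tr]
        continuous_on_subset[OF continuous_on_product_coordinates]) auto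
  ultimately obtain f where "f \<in> M" "\<And>g. g \<in> M \<Longrightarrow> (\<Sum>i<N. defect (f i)) \<le> (\<Sum>i<N. defect (g i))"
    using continuous_attains_inf[of M "\<lambda>f. \<Sum>i<N. defect (f i)"] by blast
  then show ?thesis by (intro that[of f]) (simp_all add: M_def)
qed

text \<open>\<open>single\<close> says that replacing c by a conjugate keeps c d in its class;
  \<open>fine\<close> supplies the cheap factorization that forces the minimal one to be
  cheap.\<close>

lemma commute_if_single_class:
  assumes cd: "c \<in> K" "d \<in> K"
    and fine: "\<And>\<epsilon>. \<epsilon> > 0 \<Longrightarrow> \<exists>N f. (\<forall>i. f i \<in> K) \<and> comp_upto f N = c o\<^sub>L d \<and> (\<Sum>i<N. defect (f i)) < \<epsilon>"
    and single: "\<And>Q. Q \<in> K \<Longrightarrow> \<exists>B\<in>K. (Q o\<^sub>L (c o\<^sub>L J Q)) o\<^sub>L d = B o\<^sub>L ((c o\<^sub>L d) o\<^sub>L J B)"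
  shows "c o\<^sub>L d = d o\<^sub>L c"
proof -
  \<comment> \<open>The radius within which traces against tangent vectors determine an element;
    \<open>fine\<close> is used for this value alone.\<close>
  obtain \<delta> where \<delta>: "\<delta> > 0" and inj: "\<And>A B. A \<in> K \<Longrightarrow> B \<in> K \<Longrightarrow> defect A < \<delta> \<Longrightarrow> defect B < \<delta> \<Longrightarrow>
     (\<And>X. tangent X \<Longrightarrow> tr (X o\<^sub>L A) = tr (X o\<^sub>L B)) \<Longrightarrow> A = B"
    using locally_determined_by_tangent_traces by meson
  obtain N f0 where f0: "\<And>i. f0 i \<in> K" "comp_upto f0 N = c o\<^sub>L d" "(\<Sum>i<N. defect (f0 i)) < \<delta>"
    using fine[OF \<delta>] by blast
  obtain f where fK: "\<And>i. f i \<in> K" and fx: "comp_upto f N = c o\<^sub>L d"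
    and min: "\<And>g. (\<And>i. g i \<in> K) \<Longrightarrow> comp_upto g N = c o\<^sub>L d \<Longrightarrow>
        (\<Sum>i<N. defect (f i)) \<le> (\<Sum>i<N. defect (g i))"
    using ex_min_factorization[OF f0(1,2)] by metis
  have small: "defect (f i) < \<delta>" if "i < N" for i
  proof -
    have "defect (f i) \<le> (\<Sum>i<N. defect (f i))"
      using that fK by (intro member_le_sum) (auto intro: defect_nonneg)
    then show ?thesis using min[OF f0(1,2)] f0(3) by linarith
  qed
  have commute: "c o\<^sub>L (p o\<^sub>L (f i o\<^sub>L J p)) = (p o\<^sub>L (f i o\<^sub>L J p)) o\<^sub>L c"
    if i: "i < N" and p: "p = comp_upto f i" for i p
  proof -
    have pK: "p \<in> K" unfolding p by (rule comp_upto_mem[OF fK])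
    define q where "q = p o\<^sub>L (f i o\<^sub>L J p)"
    have qK: "q \<in> K" unfolding q_def by (intro comp_mem inv_mem pK fK)
    have qsmall: "defect q < \<delta>" unfolding q_def using defect_conj[OF fK pK] small[OF i] by simp
    have le: "tr ((Q o\<^sub>L (c o\<^sub>L (J Q o\<^sub>L J c))) o\<^sub>L q) \<le> tr q" if Q: "Q \<in> K" for Q
    proof -
      \<comment> \<open>The commutator of Q and c: multiplying c d by it on the left gives (Q c
        Q^-1) d, which \<open>single\<close> makes a conjugate of c d.\<close>
      define R where "R = Q o\<^sub>L (c o\<^sub>L (J Q o\<^sub>L J c))"
      define g where "g = f(i := J p o\<^sub>L (R o\<^sub>L (p o\<^sub>L f i)))"
      have RK: "R \<in> K" unfolding R_def by (intro comp_mem inv_mem cd Q)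
      have gK: "g j \<in> K" for j
        by (simp add: g_def fK comp_mem inv_mem pK RK)
      obtain B where B: "B \<in> K" "(Q o\<^sub>L (c o\<^sub>L J Q)) o\<^sub>L d = B o\<^sub>L ((c o\<^sub>L d) o\<^sub>L J B)"
        using single[OF Q] by blast
      have "comp_upto g N = R o\<^sub>L comp_upto f N"
        unfolding g_def p by (rule comp_upto_update[OF fK i])
      also have "\<dots> = R o\<^sub>L (c o\<^sub>L d)" by (simp add: fx)
      also have "\<dots> = (Q o\<^sub>L (c o\<^sub>L J Q)) o\<^sub>L d"
        unfolding R_def using cd by (intro blinfun_eqI) simp
      finally have g: "comp_upto g N = B o\<^sub>L ((c o\<^sub>L d) o\<^sub>L J B)" using B by simp
      \<comment> \<open>Conjugating every factor by B^-1 brings the product back to c d and keeps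
        each defect, so minimality of \<open>f\<close> against \<open>h\<close> is minimality
        against \<open>g\<close>.\<close>
      define h where "h j = J B o\<^sub>L (g j o\<^sub>L J (J B))" for j
      have hK: "h j \<in> K" for j
        unfolding h_def by (intro comp_mem inv_mem gK B)
      have "comp_upto h N = c o\<^sub>L d"
        unfolding h_def comp_upto_conj[OF inv_mem[OF B(1)]] g
        using B(1) by (intro blinfun_eqI) (simp add: inv_inv)
      then have "(\<Sum>i<N. defect (f i)) \<le> (\<Sum>i<N. defect (h i))"
        by (intro min hK)
      also have "\<dots> = (\<Sum>i<N. defect (g i))"
        unfolding h_def by (simp add: defect_conj gK inv_mem B(1))
      finally have "(\<Sum>i<N. defect (f i)) \<le> (\<Sum>i<N. defect (g i))" .
      \<comment> \<open>\<open>f\<close> and \<open>g\<close> differ only at place i, so comparing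
        totals compares the i-th defects, and by cyclicity of the trace those of R q and q.\<close>
      moreover have "(\<Sum>i<N. defect (u i)) = defect (u i) + (\<Sum>j\<in>{..<N} - {i}. defect (u j))" for u
        using i by (simp add: sum.remove)
      moreover have "(\<Sum>j\<in>{..<N} - {i}. defect (f j)) = (\<Sum>j\<in>{..<N} - {i}. defect (g j))"
        by (rule sum.cong) (auto simp: g_def)
      ultimately have "defect (f i) \<le> defect (g i)" by simp
      then have "tr (g i) \<le> tr (f i)" by (simp add: defect_def)
      moreover have "tr (g i) = tr (R o\<^sub>L q)"
        unfolding g_def q_def by (simp add: tr_compose_commute[of "J p"] blinfun_compose_assoc)
      moreover have "tr q = tr (f i)"
        unfolding q_def using defect_conj[OF fK pK] by (simp add: defect_def)
      ultimately show ?thesis by (simp add: R_def)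
    qed
    \<comment> \<open>First variation of \<open>le\<close> at Q = 1: the derivative of Q c Q^-1 c^-1
      in the direction X is X - c X c^-1.\<close>
    have le0: "tr ((X - (c o\<^sub>L (X o\<^sub>L J c))) o\<^sub>L q) \<le> 0" if "tangent X" for X
    proof -
      obtain Q t where Q: "\<And>n. Q n \<in> K" "\<And>n. 0 < t n" "t \<longlonglongrightarrow> 0"
          "(\<lambda>n::nat. (Q n - id_blinfun) /\<^sub>R t n) \<longlonglongrightarrow> X"
        using tangentE[OF \<open>tangent X\<close>] by metis
      \<comment> \<open>The difference quotient of the commutator, split by the product rule into
        two quotients with known limits.\<close>
      define Y where "Y n = (((Q n - id_blinfun) /\<^sub>R t n) o\<^sub>L (c o\<^sub>L (J (Q n) o\<^sub>L J c)))
           + (c o\<^sub>L (((J (Q n) - id_blinfun) /\<^sub>R t n) o\<^sub>L J c))" for n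
      have "tr (Y n o\<^sub>L q) \<le> 0" for n
      proof -
        have "Y n o\<^sub>L q = inverse (t n) *\<^sub>R (((Q n o\<^sub>L (c o\<^sub>L (J (Q n) o\<^sub>L J c))) o\<^sub>L q) - q)"
          unfolding Y_def using cd by (intro blinfun_eqI) (simp add: blinfun.bilinear_simps algebra_simps)
        then have "tr (Y n o\<^sub>L q) = inverse (t n) * (tr ((Q n o\<^sub>L (c o\<^sub>L (J (Q n) o\<^sub>L J c))) o\<^sub>L q) - tr q)"
          by (simp add: linear_cmul[OF tr_linear] linear_diff[OF tr_linear])
        then show ?thesis using le[OF Q(1)[of n]] Q(2)[of n]
          by (simp add: mult_nonneg_nonpos)
      qed
      moreover have "(\<lambda>n. tr (Y n o\<^sub>L q)) \<longlonglongrightarrow> tr (((X o\<^sub>L (c o\<^sub>L (id_blinfun o\<^sub>L J c))) + (c o\<^sub>L (- X o\<^sub>L J c))) o\<^sub>L q)"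
        unfolding Y_def
        by (intro bounded_linear.tendsto[OF bounded_linear_tr] tendsto_intros Q(4)
            tangent_inv_limit[OF Q] inv_limit Q(1) tangent_limit[OF Q(2-4)])
      ultimately have "tr (((X o\<^sub>L (c o\<^sub>L (id_blinfun o\<^sub>L J c))) + (c o\<^sub>L (- X o\<^sub>L J c))) o\<^sub>L q) \<le> 0"
        by (intro LIMSEQ_le_const2) auto
      moreover have "(X o\<^sub>L (c o\<^sub>L (id_blinfun o\<^sub>L J c))) + (c o\<^sub>L (- X o\<^sub>L J c)) = X - (c o\<^sub>L (X o\<^sub>L J c))"
        using cd by (intro blinfun_eqI) (simp add: blinfun.bilinear_simps)
      ultimately show ?thesis by simp
    qed
    \<comment> \<open>Applied to X and to -X, \<open>le0\<close> gives equality; moving c around the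
      trace, q and c^-1 q c have the same traces against all tangent vectors. Both have small
      defect, so they coincide.\<close>
    have "tr (X o\<^sub>L q) = tr (X o\<^sub>L (J c o\<^sub>L (q o\<^sub>L J (J c))))" if "tangent X" for X
    proof -
      have "(- X - (c o\<^sub>L (- X o\<^sub>L J c))) o\<^sub>L q = - ((X - (c o\<^sub>L (X o\<^sub>L J c))) o\<^sub>L q)"
        by (intro blinfun_eqI) (simp add: blinfun.bilinear_simps)
      then have "tr ((X - (c o\<^sub>L (X o\<^sub>L J c))) o\<^sub>L q) = 0"
        using le0[OF that] le0[OF tangent_minus[OF that]] by (simp add: linear_neg[OF tr_linear])
      moreover have "(X - (c o\<^sub>L (X o\<^sub>L J c))) o\<^sub>L q = (X o\<^sub>L q) - (c o\<^sub>L (X o\<^sub>L (J c o\<^sub>L q)))"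
        by (intro blinfun_eqI) (simp add: blinfun.bilinear_simps)
      ultimately have "tr (X o\<^sub>L q) = tr (c o\<^sub>L (X o\<^sub>L (J c o\<^sub>L q)))"
        by (simp add: linear_diff[OF tr_linear])
      also have "\<dots> = tr (X o\<^sub>L (J c o\<^sub>L (q o\<^sub>L J (J c))))"
        using cd by (simp add: tr_compose_commute[of c] blinfun_compose_assoc inv_inv)
      finally show ?thesis .
    qed
    moreover have "J c o\<^sub>L (q o\<^sub>L J (J c)) \<in> K" by (intro comp_mem inv_mem qK cd)
    moreover have "defect (J c o\<^sub>L (q o\<^sub>L J (J c))) < \<delta>"
      using defect_conj[OF qK inv_mem[OF cd(1)]] qsmall by simp
    ultimately have "q = J c o\<^sub>L (q o\<^sub>L J (J c))"
      using inj[OF qK] qsmall by blast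
    then have "c o\<^sub>L q = c o\<^sub>L (J c o\<^sub>L (q o\<^sub>L c))" using cd by (simp add: inv_inv)
    also have "\<dots> = q o\<^sub>L c" using cd by (intro blinfun_eqI) simp
    finally show ?thesis by (simp add: q_def)
  qed
  \<comment> \<open>If c commutes with the partial product p and with p f_n p^-1, it commutes with
    (p f_n p^-1) p, the next partial product.\<close>
  have "c o\<^sub>L comp_upto f n = comp_upto f n o\<^sub>L c" if "n \<le> N" for n
    using that
  proof (induction n)
    case (Suc n)
    define p where "p = comp_upto f n"
    have pK: "p \<in> K" unfolding p_def by (rule comp_upto_mem[OF fK])
    have eq: "p o\<^sub>L f n = (p o\<^sub>L (f n o\<^sub>L J p)) o\<^sub>L p"
      using pK by (intro blinfun_eqI) simp
    have "c o\<^sub>L (p o\<^sub>L f n) = (c o\<^sub>L (p o\<^sub>L (f n o\<^sub>L J p))) o\<^sub>L p"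
      unfolding blinfun_compose_assoc using pK by (simp add: inv_left)
    also have "\<dots> = (p o\<^sub>L (f n o\<^sub>L J p)) o\<^sub>L (c o\<^sub>L p)"
      using commute[OF _ p_def] Suc.prems by (simp add: blinfun_compose_assoc)
    also have "c o\<^sub>L p = p o\<^sub>L c"
      using Suc by (simp add: p_def)
    also have "(p o\<^sub>L (f n o\<^sub>L J p)) o\<^sub>L (p o\<^sub>L c) = (p o\<^sub>L f n) o\<^sub>L c"
      using pK by (intro blinfun_eqI) simp
    finally show ?case by (simp add: p_def)
  qed simp
  from this[of N] have "c o\<^sub>L (c o\<^sub>L d) = (c o\<^sub>L d) o\<^sub>L c" by (simp add: fx)
  then have "J c o\<^sub>L (c o\<^sub>L (c o\<^sub>L d)) = J c o\<^sub>L ((c o\<^sub>L d) o\<^sub>L c)" by simp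
  moreover have "J c o\<^sub>L (c o\<^sub>L (c o\<^sub>L d)) = c o\<^sub>L d" "J c o\<^sub>L ((c o\<^sub>L d) o\<^sub>L c) = d o\<^sub>L c"
    using cd by (intro blinfun_eqI; simp)+
  ultimately show ?thesis by simp
qed

end

section \<open>Invariant inner products\<close>

text \<open>The squared Hilbert-Schmidt norm of the Gram matrix of the form x . S y pulled back
  along \<open>A\<close>. Pulling the form itself back by a group element only replaces
  \<open>A\<close> by another group element.\<close>

definition form_size :: "('e::euclidean_space \<Rightarrow>\<^sub>L 'e) \<Rightarrow> ('e \<Rightarrow>\<^sub>L 'e) \<Rightarrow> real" where
  "form_size A S = (\<Sum>b\<in>Basis. \<Sum>c\<in>Basis. (A b \<bullet> S (A c))\<^sup>2)"

lemma continuous_form_size: "continuous_on X (\<lambda>A. form_size A S)" "continuous_on X (\<lambda>S. form_size A S)"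
  unfolding form_size_def by (intro continuous_intros)+

lemma form_size_nonneg: "0 \<le> form_size A S"
  unfolding form_size_def by (intro sum_nonneg) simp

text \<open>The parallelogram law for each matrix entry. The subtracted term is the quantitative
  strict convexity from which uniqueness of the minimiser follows.\<close>

lemma form_size_midpoint:
  "form_size A ((1/2) *\<^sub>R (S + S')) = (form_size A S + form_size A S') / 2 - form_size A (S - S') / 4"
proof -
  have "((x + y) / 2)\<^sup>2 = x\<^sup>2 / 2 + y\<^sup>2 / 2 - (x - y)\<^sup>2 / 4" for x y :: real
    by (simp add: power2_eq_square field_simps)
  then have *: "(A b \<bullet> ((1/2) *\<^sub>R (S + S')) (A c))\<^sup>2 =
      (A b \<bullet> S (A c))\<^sup>2 / 2 + (A b \<bullet> S' (A c))\<^sup>2 / 2 - (A b \<bullet> (S - S') (A c))\<^sup>2 / 4" for b c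
    by (simp add: blinfun.bilinear_simps inner_simps)
  show ?thesis
    unfolding form_size_def *
    by (simp add: sum.distrib sum_subtractf add_divide_distrib flip: sum_divide_distrib)
qed

lemma form_expand:
  fixes A S :: "'e::euclidean_space \<Rightarrow>\<^sub>L 'e"
  shows "A x \<bullet> S (A y) = (\<Sum>b\<in>Basis. \<Sum>c\<in>Basis. (x \<bullet> b) * (y \<bullet> c) * (A b \<bullet> S (A c)))"
proof -
  have *: "A z = (\<Sum>b\<in>Basis. (z \<bullet> b) *\<^sub>R A b)" for z
  proof -
    have "A z = A (\<Sum>b\<in>Basis. (z \<bullet> b) *\<^sub>R b)" by (simp add: euclidean_representation)
    then show ?thesis by (simp add: blinfun.sum_right blinfun.scaleR_right)
  qed
  show ?thesis
    by (subst *[of x], subst *[of y])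
       (simp add: blinfun.sum_right blinfun.scaleR_right inner_sum_left inner_sum_right
          mult_ac sum_distrib_left, rule sum.swap)
qed

lemma form_size_eq_0:
  assumes "form_size A S = 0" shows "A x \<bullet> S (A y) = 0"
proof -
  have "\<forall>b\<in>Basis. (\<Sum>c\<in>Basis. (A b \<bullet> S (A c))\<^sup>2) = 0"
    using assms unfolding form_size_def
    by (subst (asm) sum_nonneg_eq_0_iff) (auto intro: sum_nonneg)
  then have "A b \<bullet> S (A c) = 0" if "b \<in> Basis" "c \<in> Basis" for b c
    using that by (auto simp: sum_nonneg_eq_0_iff)
  then show ?thesis by (simp add: form_expand[of A x])
qed

text \<open>
  The invariant form is the unique minimiser of a strictly convex function that is invariant
  under the group, so no invariant measure is needed.
\<close>

lemma ex_invariant_form: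
  fixes K :: "('e::euclidean_space \<Rightarrow>\<^sub>L 'e) set"
  assumes compact: "compact K" and id: "id_blinfun \<in> K"
    and comp: "\<And>A B. A \<in> K \<Longrightarrow> B \<in> K \<Longrightarrow> A o\<^sub>L B \<in> K"
    and inv: "\<And>A. A \<in> K \<Longrightarrow> \<exists>B\<in>K. B o\<^sub>L A = id_blinfun \<and> A o\<^sub>L B = id_blinfun"
  obtains S :: "'e \<Rightarrow>\<^sub>L 'e" where "\<And>x y. x \<bullet> S y = S x \<bullet> y" "\<And>x. x \<bullet> x \<le> x \<bullet> S x"
    "\<And>A x y. A \<in> K \<Longrightarrow> A x \<bullet> S (A y) = x \<bullet> S y"
proof -
  obtain M where M: "\<And>A. A \<in> K \<Longrightarrow> norm A \<le> M"
    using compact_imp_bounded[OF compact] unfolding bounded_iff by blast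
  \<comment> \<open>A first competitor: \<open>M\<close> also bounds the inverses of elements of
    \<open>K\<close>, so |x| <= M |A x|, which is the positivity demanded in
    \<open>Q\<close>.\<close>
  define S0 :: "'e \<Rightarrow>\<^sub>L 'e" where "S0 = M\<^sup>2 *\<^sub>R id_blinfun"
  have "bounded ((\<lambda>A. form_size A S0) ` K)"
    by (intro compact_imp_bounded compact_continuous_image compact continuous_form_size)
  then obtain R where R: "\<And>A. A \<in> K \<Longrightarrow> form_size A S0 \<le> R"
    unfolding bounded_iff by (auto simp: abs_le_iff)
  have "0 \<le> R" using R[OF id] form_size_nonneg[of id_blinfun S0] by linarith
  \<comment> \<open>The epigraph of the supremum of \<open>form_size A S\<close> over A in
    \<open>K\<close>, cut off at height \<open>R\<close> to be compact; minimising the height r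
    minimises the supremum. Positivity is demanded along all of \<open>K\<close> so that it survives
    pulling back.\<close>
  define Q where "Q = {(S, r). (\<forall>x y. x \<bullet> blinfun_apply S y = S x \<bullet> y) \<and>
     (\<forall>A\<in>K. \<forall>x. x \<bullet> x \<le> A x \<bullet> S (A x)) \<and> (\<forall>A\<in>K. form_size A S \<le> r) \<and> r \<le> R}"
  have QI: "(S, r) \<in> Q" if "\<And>x y. x \<bullet> blinfun_apply S y = S x \<bullet> y"
    "\<And>A x. A \<in> K \<Longrightarrow> x \<bullet> x \<le> A x \<bullet> S (A x)" "\<And>A. A \<in> K \<Longrightarrow> form_size A S \<le> r" "r \<le> R" for S r
    using that by (simp add: Q_def)
  have QD: "\<And>x y. x \<bullet> blinfun_apply S y = S x \<bullet> y"
    "\<And>A x. A \<in> K \<Longrightarrow> x \<bullet> x \<le> A x \<bullet> S (A x)" "\<And>A. A \<in> K \<Longrightarrow> form_size A S \<le> r" "r \<le> R"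
    if "(S, r) \<in> Q" for S r
    using that unfolding Q_def by blast+
  have "(S0, R) \<in> Q"
  proof (rule QI)
    fix A x assume A: "A \<in> K"
    then obtain B where B: "B \<in> K" "B o\<^sub>L A = id_blinfun" using inv by blast
    have "norm x = norm (B (A x))"
      using B(2) by (metis blinfun_apply_blinfun_compose blinfun_apply_id_blinfun)
    also have "\<dots> \<le> M * norm (A x)"
      using norm_blinfun[of B "A x"] mult_right_mono[OF M[OF B(1)], of "norm (A x)"] by simp
    finally have "(norm x)\<^sup>2 \<le> (M * norm (A x))\<^sup>2" by (intro power_mono) auto
    then show "x \<bullet> x \<le> A x \<bullet> S0 (A x)"
      by (simp add: S0_def blinfun.bilinear_simps power_mult_distrib power2_norm_eq_inner)
  qed (use R in \<open>auto simp: S0_def blinfun.bilinear_simps\<close>)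
  have "compact Q"
  proof -
    have "closed Q"
    proof -
      have "Q = (\<Inter>x. \<Inter>y. {p. x \<bullet> blinfun_apply (fst p) y = blinfun_apply (fst p) x \<bullet> y}) \<inter>
        (\<Inter>A\<in>K. \<Inter>x. {p. x \<bullet> x \<le> blinfun_apply A x \<bullet> blinfun_apply (fst p) (blinfun_apply A x)}) \<inter>
        (\<Inter>A\<in>K. {p. form_size A (fst p) \<le> snd p}) \<inter> {p. snd p \<le> R}"
        unfolding Q_def by auto
      also have "closed \<dots>"
        by (intro closed_Int closed_INT ballI closed_Collect_eq closed_Collect_le continuous_intros
            continuous_on_compose2[OF continuous_form_size(2)[of UNIV]]) auto
      finally show ?thesis .
    qed
    moreover have "bounded Q"
    proof -
      have "norm p \<le> real DIM('e) * (real DIM('e) * sqrt R) + R" if "p \<in> Q" for p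
      proof -
        obtain S r where p: "p = (S, r)" by (cases p)
        note * = QD[OF that[unfolded p]]
        have le: "form_size id_blinfun S \<le> R" using *(3)[OF id] *(4) by simp
        have "\<bar>b \<bullet> S c\<bar> \<le> sqrt R" if "b \<in> Basis" "c \<in> Basis" for b c
        proof -
          have "(b \<bullet> S c)\<^sup>2 \<le> (\<Sum>c\<in>Basis. (b \<bullet> S c)\<^sup>2)"
            using that by (intro member_le_sum) auto
          also have "\<dots> \<le> (\<Sum>b\<in>Basis. \<Sum>c\<in>Basis. (b \<bullet> S c)\<^sup>2)"
            using that by (intro member_le_sum[where f = "\<lambda>b. \<Sum>c\<in>Basis. (b \<bullet> S c)\<^sup>2"]) (auto intro: sum_nonneg)
          also have "\<dots> \<le> R" using le by (simp add: form_size_def)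
          finally show ?thesis by (metis real_sqrt_abs real_sqrt_le_iff)
        qed
        then have "norm (S c) \<le> real DIM('e) * sqrt R" if "c \<in> Basis" for c
          using norm_le_l1[of "S c"] sum_bounded_above[of Basis "\<lambda>b. \<bar>S c \<bullet> b\<bar>" "sqrt R"] that
          by (simp add: inner_commute)
        then have "norm S \<le> real DIM('e) * (real DIM('e) * sqrt R)"
          using norm_blinfun_euclidean_le[of S]
            sum_bounded_above[of Basis "\<lambda>b. norm (S b)" "real DIM('e) * sqrt R"] by simp
        moreover have "\<bar>r\<bar> \<le> R"
          using *(3)[OF id] *(4) form_size_nonneg[of id_blinfun S] by simp
        ultimately show ?thesis
          unfolding p using norm_Pair_le[of S r] by simp
      qed
      then show ?thesis unfolding bounded_iff by blast
    qed
    ultimately show ?thesis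
      by (simp add: compact_eq_bounded_closed)
  qed
  then obtain p where p: "p \<in> Q" "\<And>q. q \<in> Q \<Longrightarrow> snd p \<le> snd q"
    using continuous_attains_inf[OF _ _ continuous_on_snd[OF continuous_on_id], of Q] \<open>(S0, R) \<in> Q\<close>
    by blast
  obtain S m where p_eq: "p = (S, m)" by (cases p)
  note S = QD[OF p(1)[unfolded p_eq]]
  have invariant: "B x \<bullet> S (B y) = x \<bullet> S y" if B: "B \<in> K" for B x y
  proof -
    \<comment> \<open>The operator of the form pulled back by \<open>B\<close>. It obeys the same
      bound \<open>m\<close> as \<open>S\<close>, because B A stays in \<open>K\<close>.\<close>
    define S' where "S' = Blinfun (\<lambda>y. \<Sum>b\<in>Basis. (B b \<bullet> S (B y)) *\<^sub>R b)"
    have "bounded_linear (\<lambda>y. \<Sum>b\<in>Basis. (B b \<bullet> S (B y)) *\<^sub>R b)"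
      by (intro bounded_linear_sum bounded_linear_scaleR_const
          bounded_linear_inner_right_comp blinfun.bounded_linear_right
          bounded_linear_compose[OF blinfun.bounded_linear_right])
    then have S'_apply: "S' y = (\<Sum>b\<in>Basis. (B b \<bullet> S (B y)) *\<^sub>R b)" for y
      unfolding S'_def by (simp add: bounded_linear_Blinfun_apply)
    have S': "x \<bullet> S' y = B x \<bullet> S (B y)" for x y
    proof -
      have "B x = B (\<Sum>b\<in>Basis. (x \<bullet> b) *\<^sub>R b)" by (simp add: euclidean_representation)
      then have "B x \<bullet> S (B y) = (\<Sum>b\<in>Basis. (x \<bullet> b) * (B b \<bullet> S (B y)))"
        by (simp add: blinfun.sum_right blinfun.scaleR_right inner_sum_left)
      then show ?thesis by (simp add: S'_apply inner_sum_right mult.commute)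
    qed
    have S'_size: "form_size A S' = form_size (B o\<^sub>L A) S" for A
      by (simp add: form_size_def S')
    define U where "U = (1/2) *\<^sub>R (S + S')"
    have U: "x \<bullet> U y = (x \<bullet> S y + x \<bullet> S' y) / 2" for x y
      by (simp add: U_def blinfun.bilinear_simps inner_simps)
    \<comment> \<open>Otherwise compactness gives a positive minimum of these gaps over
      \<open>K\<close>, and the midpoint \<open>U\<close> lowers the height by a quarter of it,
      against the minimality of \<open>m\<close>.\<close>
    have "\<exists>A\<in>K. form_size A (S - S') \<le> 0"
    proof (rule ccontr)
      assume "\<not> ?thesis"
      then have pos: "\<And>A. A \<in> K \<Longrightarrow> 0 < form_size A (S - S')" by force
      obtain A0 where A0: "A0 \<in> K" "\<And>A. A \<in> K \<Longrightarrow> form_size A0 (S - S') \<le> form_size A (S - S')"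
        using continuous_attains_inf[OF compact _ continuous_form_size(1), of "S - S'"] id by blast
      have "(U, m - form_size A0 (S - S') / 4) \<in> Q"
      proof (rule QI)
        fix x y
        have "x \<bullet> S' y = S' x \<bullet> y"
          using S(1)[of "B x" "B y"] S'[of x y] S'[of y x] by (simp add: inner_commute)
        then show "x \<bullet> U y = U x \<bullet> y"
          using U[of x y] U[of y x] S(1)[of x y] by (simp add: inner_commute)
      next
        fix A x assume "A \<in> K"
        then have "x \<bullet> x \<le> A x \<bullet> S (A x)" "x \<bullet> x \<le> B (A x) \<bullet> S (B (A x))"
          using S(2)[of A x] S(2)[OF comp[OF B], of A x] by simp_all
        then show "x \<bullet> x \<le> A x \<bullet> U (A x)" by (simp add: U S')
      next
        fix A assume A: "A \<in> K"
        then show "form_size A U \<le> m - form_size A0 (S - S') / 4"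
          using A0(2)[OF A] S(3)[OF A] S(3)[OF comp[OF B A]]
          unfolding U_def form_size_midpoint S'_size by argo
      next
        show "m - form_size A0 (S - S') / 4 \<le> R" using S(4) pos[OF A0(1)] by simp
      qed
      from p(2)[OF this] pos[OF A0(1)] show False by (simp add: p_eq)
    qed
    then obtain A where A: "A \<in> K" "form_size A (S - S') = 0"
      using form_size_nonneg by (metis order_antisym)
    \<comment> \<open>One \<open>A\<close> is enough: it is invertible, so a form that vanishes
      after pulling back along it is zero.\<close>
    obtain A' where "A o\<^sub>L A' = id_blinfun" using inv[OF A(1)] by blast
    then have "A (A' z) = z" for z by (metis blinfun_apply_blinfun_compose blinfun_apply_id_blinfun)
    then have "x \<bullet> (S - S') y = 0"
      using form_size_eq_0[OF A(2), of "A' x" "A' y"] by simp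
    then show ?thesis by (simp add: blinfun.diff_left inner_diff_right S')
  qed
  show ?thesis
  proof (rule that[of S])
    show "x \<bullet> x \<le> x \<bullet> S x" for x using S(2)[OF id, of x] by simp
  qed (use S(1) invariant in auto)
qed

text \<open>A set orthonormal for the form x . S y and of largest cardinality is a basis, since a
  nonzero vector orthogonal to it could be normalised and added; \<open>T\<close> sends it to
  standard basis vectors.\<close>

lemma ex_orthonormalizing_map:
  fixes S :: "'e::euclidean_space \<Rightarrow>\<^sub>L 'e"
  assumes sym: "\<And>x y. x \<bullet> S y = S x \<bullet> y" and pos: "\<And>x. x \<bullet> x \<le> x \<bullet> S x"
  obtains T T' :: "'e \<Rightarrow>\<^sub>L 'e" where "T' o\<^sub>L T = id_blinfun" "T o\<^sub>L T' = id_blinfun"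
    "\<And>x y. T x \<bullet> T y = x \<bullet> S y"
proof -
  define P where "P B \<longleftrightarrow> finite B \<and> (\<forall>u\<in>B. \<forall>v\<in>B. u \<bullet> S v = (if u = v then 1 else 0))" for B :: "'e set"
  have sym': "x \<bullet> S y = y \<bullet> S x" for x y using sym[of x y] by (simp add: inner_commute)
  have coeff: "(\<Sum>u\<in>B. f u *\<^sub>R u) \<bullet> S v = f v" if "P B" "v \<in> B" for B f v
  proof -
    have "(\<Sum>u\<in>B. f u *\<^sub>R u) \<bullet> S v = (\<Sum>u\<in>B. f u * (u \<bullet> S v))"
      by (simp add: inner_sum_left)
    also have "\<dots> = (\<Sum>u\<in>B. if u = v then f v else 0)"
      using that by (intro sum.cong) (auto simp: P_def)
    finally show ?thesis using that by (simp add: P_def)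
  qed
  have card: "card B \<le> DIM('e)" if "P B" for B
  proof (rule conjunct2[OF independent_bound])
    show "independent B"
      unfolding independent_explicit
    proof (intro conjI allI impI ballI)
      fix f v assume "(\<Sum>u\<in>B. f u *\<^sub>R u) = 0" "v \<in> B"
      then show "f v = 0" using coeff[OF that, of v f] by simp
    qed (use that in \<open>simp add: P_def\<close>)
  qed
  have "P {}" by (simp add: P_def)
  then obtain B where B: "P B" and max: "\<And>B'. P B' \<Longrightarrow> card B' \<le> card B"
    using ex_has_greatest_nat[of P "{}" card "Suc DIM('e)"] card by (metis le_imp_less_Suc)
  have fin: "finite B" using B by (simp add: P_def)
  have zero: "w = 0" if w: "\<And>v. v \<in> B \<Longrightarrow> w \<bullet> S v = 0" for w
  proof (rule ccontr)
    assume "w \<noteq> 0"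
    then have "0 < w \<bullet> S w" using pos[of w] inner_gt_zero_iff[of w] by linarith
    define z where "z = (1 / sqrt (w \<bullet> S w)) *\<^sub>R w"
    have z: "z \<bullet> S z = 1"
      using \<open>0 < w \<bullet> S w\<close> by (simp add: z_def blinfun.scaleR_right)
    have zB: "z \<bullet> S v = 0" if "v \<in> B" for v using w[OF that] by (simp add: z_def)
    moreover have Bz: "v \<bullet> S z = 0" if "v \<in> B" for v using zB[OF that] sym'[of v z] by simp
    ultimately have "z \<notin> B" using z by auto
    have "P (insert z B)"
      using B \<open>z \<notin> B\<close> unfolding P_def by (auto simp: z zB Bz)
    then show False using max[of "insert z B"] fin \<open>z \<notin> B\<close> by simp
  qed
  have expand: "x = (\<Sum>u\<in>B. (x \<bullet> S u) *\<^sub>R u)" for x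
  proof -
    have "x - (\<Sum>u\<in>B. (x \<bullet> S u) *\<^sub>R u) = 0"
      by (rule zero) (simp add: inner_diff_left coeff[OF B])
    then show ?thesis by simp
  qed
  \<comment> \<open>An injection is enough: \<open>T\<close> carries the form to the inner product,
    so it is injective by positivity and bijective by dimension.\<close>
  obtain h where h: "inj_on h B" "h ` B \<subseteq> (Basis :: 'e set)"
    using card_le_inj[OF fin finite_Basis card[OF B]] by metis
  define T where "T = Blinfun (\<lambda>x. \<Sum>u\<in>B. (x \<bullet> S u) *\<^sub>R h u)"
  have "bounded_linear (\<lambda>x. \<Sum>u\<in>B. (x \<bullet> S u) *\<^sub>R h u)"
    by (intro bounded_linear_sum bounded_linear_scaleR_const bounded_linear_inner_left)
  then have T_apply: "T x = (\<Sum>u\<in>B. (x \<bullet> S u) *\<^sub>R h u)" for x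
    unfolding T_def by (simp add: bounded_linear_Blinfun_apply)
  have T: "T x \<bullet> T y = x \<bullet> S y" for x y
  proof -
    have "T x \<bullet> h v = x \<bullet> S v" if "v \<in> B" for v
    proof -
      have "T x \<bullet> h v = (\<Sum>u\<in>B. (x \<bullet> S u) * (h u \<bullet> h v))"
        by (simp add: T_apply inner_sum_left)
      also have "\<dots> = (\<Sum>u\<in>B. if u = v then x \<bullet> S v else 0)"
      proof (rule sum.cong)
        fix u assume "u \<in> B"
        then have "h u \<bullet> h v = (if u = v then 1 else 0)"
          using h that inner_Basis[of "h u" "h v"] by (auto simp: inj_on_def image_subset_iff)
        then show "(x \<bullet> S u) * (h u \<bullet> h v) = (if u = v then x \<bullet> S v else 0)" by simp
      qed simp
      finally show ?thesis using fin that by simp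
    qed
    then have "T x \<bullet> T y = (\<Sum>u\<in>B. (y \<bullet> S u) * (x \<bullet> S u))"
      by (subst T_apply[of y]) (simp add: inner_sum_right)
    also have "\<dots> = S x \<bullet> (\<Sum>u\<in>B. (y \<bullet> S u) *\<^sub>R u)"
      by (simp add: inner_sum_right sym)
    also have "\<dots> = x \<bullet> S y"
      unfolding expand[of y, symmetric] by (rule sym[symmetric])
    finally show ?thesis .
  qed
  have "linear (blinfun_apply T)" by (simp add: blinfun.bounded_linear_right bounded_linear.linear)
  moreover have "inj (blinfun_apply T)"
  proof (rule linear_injective_0[THEN iffD2, rule_format])
    fix x assume "T x = 0"
    then have "x \<bullet> x \<le> 0" using pos[of x] T[of x x] by simp
    then show "x = 0" using inner_gt_zero_iff[of x] by linarith
  qed fact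
  ultimately obtain f where f: "linear f" "\<And>x. f (T x) = x" "\<And>x. T (f x) = x"
    using linear_injective_isomorphism[of "blinfun_apply T"] by blast
  define T' where "T' = Blinfun f"
  have T'_apply: "T' x = f x" for x
    unfolding T'_def using f(1) by (simp add: bounded_linear_Blinfun_apply linear_conv_bounded_linear)
  show ?thesis
    by (rule that[of T' T]) (auto intro!: blinfun_eqI simp: T'_apply f T)
qed

text \<open>A change of basis makes the group orthogonal. \<open>fine\<close> uses the operator
  norm, because the defect that must be small belongs to the invariant inner product, chosen only
  inside the proof.\<close>

lemma commute_in_compact_group:
  fixes K :: "('e::euclidean_space \<Rightarrow>\<^sub>L 'e) set"
  assumes compact: "compact K" and id: "id_blinfun \<in> K"
    and comp: "\<And>A B. A \<in> K \<Longrightarrow> B \<in> K \<Longrightarrow> A o\<^sub>L B \<in> K"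
    and inv: "\<And>A. A \<in> K \<Longrightarrow> J A \<in> K" "\<And>A. A \<in> K \<Longrightarrow> J A o\<^sub>L A = id_blinfun"
      "\<And>A. A \<in> K \<Longrightarrow> A o\<^sub>L J A = id_blinfun"
    and cd: "c \<in> K" "d \<in> K"
    and single: "\<And>Q. Q \<in> K \<Longrightarrow> \<exists>B\<in>K. (Q o\<^sub>L (c o\<^sub>L J Q)) o\<^sub>L d = B o\<^sub>L ((c o\<^sub>L d) o\<^sub>L J B)"
    and fine: "\<And>\<epsilon>. \<epsilon> > 0 \<Longrightarrow> \<exists>N f. (\<forall>i. f i \<in> K) \<and> comp_upto f N = c o\<^sub>L d \<and>
      (\<Sum>i<N. (norm (f i - id_blinfun))\<^sup>2) < \<epsilon>"
  shows "c o\<^sub>L d = d o\<^sub>L c"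
proof -
  have "\<And>A. A \<in> K \<Longrightarrow> \<exists>B\<in>K. B o\<^sub>L A = id_blinfun \<and> A o\<^sub>L B = id_blinfun" using inv by blast
  from ex_invariant_form[OF compact id comp this]
  obtain S :: "'e \<Rightarrow>\<^sub>L 'e" where S: "\<And>x y. x \<bullet> S y = S x \<bullet> y" "\<And>x. x \<bullet> x \<le> x \<bullet> S x"
    "\<And>A x y. A \<in> K \<Longrightarrow> A x \<bullet> S (A y) = x \<bullet> S y" by metis
  obtain T T' :: "'e \<Rightarrow>\<^sub>L 'e" where T: "T' o\<^sub>L T = id_blinfun" "T o\<^sub>L T' = id_blinfun"
    "\<And>x y. T x \<bullet> T y = x \<bullet> S y"
    using ex_orthonormalizing_map[OF S(1,2)] by metis
  have T_simps [simp]: "T' (T x) = x" "T (T' x) = x" for x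
    using T(1,2) by (metis blinfun_apply_blinfun_compose blinfun_apply_id_blinfun)+
  define t where "t A = T o\<^sub>L (A o\<^sub>L T')" for A
  define t' where "t' A = T' o\<^sub>L (A o\<^sub>L T)" for A
  have t'_t [simp]: "t' (t A) = A" and t_t' [simp]: "t (t' A) = A" for A
    by (simp_all add: t_def t'_def blinfun_eqI)
  have t_comp: "t (A o\<^sub>L B) = t A o\<^sub>L t B" and t_id: "t id_blinfun = id_blinfun"
    and t_diff: "t (A - B) = t A - t B" for A B
    by (simp_all add: t_def blinfun_eqI blinfun.bilinear_simps)
  interpret compact_orthogonal_group "t ` K" "t \<circ> J \<circ> t'"
  proof
    show "compact (t ` K)"
      unfolding t_def by (intro compact_continuous_image compact continuous_intros)
    show "id_blinfun \<in> t ` K" using id t_id by (metis image_eqI)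
    fix A B assume A: "A \<in> t ` K" and "B \<in> t ` K"
    then obtain A' B' where A': "A = t A'" "A' \<in> K" and B': "B = t B'" "B' \<in> K" by blast
    show "A o\<^sub>L B \<in> t ` K" using A' B' comp by (auto simp flip: t_comp)
    show "(t \<circ> J \<circ> t') A \<in> t ` K" using A' inv by simp
    show "(t \<circ> J \<circ> t') A o\<^sub>L A = id_blinfun" "A o\<^sub>L (t \<circ> J \<circ> t') A = id_blinfun"
      using A' inv by (simp_all flip: t_comp add: t_id)
    fix v
    have "A v \<bullet> A v = v \<bullet> v"
      using T(3)[of "A' (T' v)" "A' (T' v)"] T(3)[of "T' v" "T' v"] S(3)[OF A'(2), of "T' v" "T' v"]
      by (simp add: A' t_def)
    then show "norm (A v) = norm v" by (simp add: norm_eq_sqrt_inner)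
  qed
  have tcd: "t c \<in> t ` K" "t d \<in> t ` K" using cd by auto
  have "t c o\<^sub>L t d = t d o\<^sub>L t c"
  proof (rule commute_if_single_class[OF tcd])
    show "\<exists>N f. (\<forall>i. f i \<in> t ` K) \<and> comp_upto f N = t c o\<^sub>L t d \<and> (\<Sum>i<N. defect (f i)) < \<epsilon>"
      if \<epsilon>: "\<epsilon> > 0" for \<epsilon>
    proof -
      \<comment> \<open>Conjugation by \<open>T\<close> enlarges squared distances at most by the
        squared factor, and \<open>defect_le\<close> contributes the dimension; adding 1 makes
        \<open>M\<close> positive.\<close>
      define M where "M = real DIM('e) * (norm T * norm T')\<^sup>2 + 1"
      have M: "M > 0" unfolding M_def by (intro add_nonneg_pos mult_nonneg_nonneg) auto
      then obtain N f where f: "\<And>i. f i \<in> K" "comp_upto f N = c o\<^sub>L d"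
          and less: "(\<Sum>i<N. (norm (f i - id_blinfun))\<^sup>2) < \<epsilon> / M"
        using fine[of "\<epsilon> / M"] \<epsilon> by auto
      have le: "defect (t (f i)) \<le> M * (norm (f i - id_blinfun))\<^sup>2" for i
      proof -
        have "norm (t (f i) - id_blinfun) = norm (t (f i - id_blinfun))"
          by (simp add: t_diff t_id)
        also have "\<dots> \<le> norm T * (norm (f i - id_blinfun) * norm T')"
          unfolding t_def by (meson norm_blinfun_compose mult_left_mono norm_ge_zero order_trans)
        finally have "(norm (t (f i) - id_blinfun))\<^sup>2 \<le> (norm T * norm T')\<^sup>2 * (norm (f i - id_blinfun))\<^sup>2"
          by (metis (no_types, opaque_lifting) mult.assoc mult.commute norm_ge_zero power_mono power_mult_distrib)
        then have "real DIM('e) * (norm (t (f i) - id_blinfun))\<^sup>2 \<le>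
            real DIM('e) * ((norm T * norm T')\<^sup>2 * (norm (f i - id_blinfun))\<^sup>2)"
          by (intro mult_left_mono) auto
        moreover have "defect (t (f i)) \<le> real DIM('e) * (norm (t (f i) - id_blinfun))\<^sup>2"
          using f(1) by (intro defect_le) auto
        moreover have "M * (norm (f i - id_blinfun))\<^sup>2 =
            real DIM('e) * ((norm T * norm T')\<^sup>2 * (norm (f i - id_blinfun))\<^sup>2) + (norm (f i - id_blinfun))\<^sup>2"
          by (simp add: M_def algebra_simps)
        ultimately show ?thesis using zero_le_power2[of "norm (f i - id_blinfun)"] by linarith
      qed
      have "(\<Sum>i<N. defect (t (f i))) \<le> (\<Sum>i<N. M * (norm (f i - id_blinfun))\<^sup>2)"
        by (intro sum_mono le)
      also have "\<dots> < \<epsilon>"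
        using less M by (simp add: sum_distrib_left[symmetric] field_simps)
      finally have "(\<Sum>i<N. defect (t (f i))) < \<epsilon>" .
      moreover have "comp_upto (\<lambda>i. t (f i)) n = t (comp_upto f n)" for n
        by (induction n) (simp_all add: t_id t_comp)
      ultimately show "\<exists>N f. (\<forall>i. f i \<in> t ` K) \<and> comp_upto f N = t c o\<^sub>L t d \<and> (\<Sum>i<N. defect (f i)) < \<epsilon>"
        using f by (intro exI[of _ N] exI[of _ "\<lambda>i. t (f i)"]) (simp add: t_comp)
    qed
    fix Q assume "Q \<in> t ` K"
    then obtain Q' where Q': "Q = t Q'" "Q' \<in> K" by blast
    obtain B where B: "B \<in> K" "(Q' o\<^sub>L (c o\<^sub>L J Q')) o\<^sub>L d = B o\<^sub>L ((c o\<^sub>L d) o\<^sub>L J B)"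
      using single[OF Q'(2)] by blast
    from arg_cong[OF B(2), of t] B(1)
    show "\<exists>B\<in>t ` K. (Q o\<^sub>L (t c o\<^sub>L (t \<circ> J \<circ> t') Q)) o\<^sub>L t d = B o\<^sub>L ((t c o\<^sub>L t d) o\<^sub>L (t \<circ> J \<circ> t') B)"
      by (intro bexI[of _ "t B"]) (simp_all add: t_comp Q')
  qed
  then have "t' (t (c o\<^sub>L d)) = t' (t (d o\<^sub>L c))" by (simp only: t_comp)
  then show ?thesis by simp
qed

section \<open>Local Lipschitz continuity\<close>

text \<open>Fine factorizations rest on this rate: a Lipschitz bound turns N steps of length 1/N
  into squares whose sum is of order 1/N, which bare continuity would not give.\<close>

definition lip_at :: "('a::metric_space \<Rightarrow> 'b::metric_space) \<Rightarrow> 'a \<Rightarrow> bool" where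
  "lip_at f z \<longleftrightarrow> (\<exists>r>0. \<exists>L. L-lipschitz_on (ball z r) f)"

lemma lip_atI:
  assumes "r > 0" "0 \<le> L" "\<And>x y. dist z x < r \<Longrightarrow> dist z y < r \<Longrightarrow> dist (f x) (f y) \<le> L * dist x y"
  shows "lip_at f z"
  unfolding lip_at_def lipschitz_on_def using assms by (intro exI[of _ r] exI[of _ L]) auto

lemma lip_atE:
  assumes "lip_at f z"
  obtains r L where "r > 0" "0 \<le> L" "\<And>x y. dist z x < r \<Longrightarrow> dist z y < r \<Longrightarrow> dist (f x) (f y) \<le> L * dist x y"
  using assms unfolding lip_at_def lipschitz_on_def by auto

lemma lip_at_const: "lip_at (\<lambda>x. c) z"
  by (rule lip_atI[of 1 0]) auto

lemma lip_at_ident: "lip_at (\<lambda>x. x) z"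
  by (rule lip_atI[of 1 1]) auto

lemma lip_at_compose:
  assumes "lip_at f z" "lip_at g (f z)" shows "lip_at (\<lambda>x. g (f x)) z"
proof -
  obtain r L where f: "r > 0" "0 \<le> L" "\<And>x y. dist z x < r \<Longrightarrow> dist z y < r \<Longrightarrow> dist (f x) (f y) \<le> L * dist x y"
    using lip_atE[OF assms(1)] by metis
  obtain s M where g: "s > 0" "0 \<le> M"
      "\<And>x y. dist (f z) x < s \<Longrightarrow> dist (f z) y < s \<Longrightarrow> dist (g x) (g y) \<le> M * dist x y"
    using lip_atE[OF assms(2)] by metis
  \<comment> \<open>The second bound keeps f inside the ball where g is Lipschitz; L + 1 avoids a
    division by zero.\<close>
  define t where "t = min r (s / (L + 1))"
  have *: "dist (f z) (f x) < s" if "dist z x < t" for x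
  proof -
    have "dist (f z) (f x) \<le> L * dist z x" using f that by (intro f(3)) (auto simp: t_def)
    also have "\<dots> \<le> (L + 1) * dist z x" by (simp add: algebra_simps)
    also have "\<dots> < s" using that f(2) by (simp add: t_def field_simps)
    finally show ?thesis .
  qed
  show ?thesis
  proof (rule lip_atI[of t "M * L"])
    fix x y assume xy: "dist z x < t" "dist z y < t"
    have "dist (g (f x)) (g (f y)) \<le> M * dist (f x) (f y)" using xy by (intro g(3) *)
    also have "\<dots> \<le> M * (L * dist x y)"
      using xy g(2) by (intro mult_left_mono f(3)) (auto simp: t_def)
    finally show "dist (g (f x)) (g (f y)) \<le> M * L * dist x y" by (simp add: mult.assoc)
  qed (use f g in \<open>auto simp: t_def\<close>)
qed

lemma lip_at_Pair:
  assumes "lip_at f z" "lip_at g z" shows "lip_at (\<lambda>x. (f x, g x)) z"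
proof -
  obtain r L where f: "r > 0" "0 \<le> L" "\<And>x y. dist z x < r \<Longrightarrow> dist z y < r \<Longrightarrow> dist (f x) (f y) \<le> L * dist x y"
    using lip_atE[OF assms(1)] by metis
  obtain s M where g: "s > 0" "0 \<le> M" "\<And>x y. dist z x < s \<Longrightarrow> dist z y < s \<Longrightarrow> dist (g x) (g y) \<le> M * dist x y"
    using lip_atE[OF assms(2)] by metis
  show ?thesis
  proof (rule lip_atI[of "min r s" "L + M"])
    fix x y assume xy: "dist z x < min r s" "dist z y < min r s"
    have "dist (f x, g x) (f y, g y) \<le> dist (f x) (f y) + dist (g x) (g y)"
      unfolding dist_Pair_Pair by (intro sqrt_sum_squares_le_sum) auto
    also have "\<dots> \<le> L * dist x y + M * dist x y"
      using xy by (intro add_mono f(3) g(3)) auto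
    finally show "dist (f x, g x) (f y, g y) \<le> (L + M) * dist x y" by (simp add: algebra_simps)
  qed (use f g in auto)
qed

text \<open>Passes from directional values, the only ones of which \<open>Ck_on\<close> speaks, to
  the operator norm, which is at most the sum of the norms on a basis.\<close>

lemma lip_at_blinfun:
  fixes f :: "'a::metric_space \<Rightarrow> ('e::euclidean_space \<Rightarrow>\<^sub>L 'b::real_normed_vector)"
  assumes "\<And>b. b \<in> Basis \<Longrightarrow> lip_at (\<lambda>x. f x b) z" shows "lip_at f z"
proof -
  have "\<forall>b\<in>Basis. \<exists>r L. r > 0 \<and> 0 \<le> L \<and>
      (\<forall>x y. dist z x < r \<longrightarrow> dist z y < r \<longrightarrow> dist (f x b) (f y b) \<le> L * dist x y)"
    using assms by (meson lip_atE)
  then obtain r L where *: "\<And>b. b \<in> Basis \<Longrightarrow> r b > 0 \<and> 0 \<le> L b \<and>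
      (\<forall>x y. dist z x < r b \<longrightarrow> dist z y < r b \<longrightarrow> dist (f x b) (f y b) \<le> L b * dist x y)"
    by metis
  show ?thesis
  proof (rule lip_atI[of "Min (r ` Basis)" "\<Sum>b\<in>Basis. L b"])
    show "Min (r ` Basis) > 0" using * by (subst Min_gr_iff) auto
    show "0 \<le> (\<Sum>b\<in>Basis. L b)" using * by (intro sum_nonneg) auto
    fix x y assume "dist z x < Min (r ` Basis)" "dist z y < Min (r ` Basis)"
    then have xy: "dist z x < r b" "dist z y < r b" if "b \<in> Basis" for b
      using that by (auto simp: Min_gr_iff)
    have "dist (f x) (f y) \<le> (\<Sum>b\<in>Basis. norm ((f x - f y) b))"
      unfolding dist_norm by (rule norm_blinfun_euclidean_le)
    also have "\<dots> \<le> (\<Sum>b\<in>Basis. L b * dist x y)"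
      using * xy by (intro sum_mono) (simp add: blinfun.diff_left flip: dist_norm)
    finally show "dist (f x) (f y) \<le> (\<Sum>b\<in>Basis. L b) * dist x y"
      by (simp add: sum_distrib_right)
  qed
qed

lemma lip_at_blinfun_compose:
  fixes f :: "'a::metric_space \<Rightarrow> ('b::real_normed_vector \<Rightarrow>\<^sub>L 'c::real_normed_vector)"
    and g :: "'a \<Rightarrow> ('d::real_normed_vector \<Rightarrow>\<^sub>L 'b)"
  assumes "lip_at f z" "lip_at g z" shows "lip_at (\<lambda>x. f x o\<^sub>L g x) z"
proof -
  obtain r L where f: "r > 0" "0 \<le> L" "\<And>x y. dist z x < r \<Longrightarrow> dist z y < r \<Longrightarrow> dist (f x) (f y) \<le> L * dist x y"
    using lip_atE[OF assms(1)] by metis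
  obtain s M where g: "s > 0" "0 \<le> M" "\<And>x y. dist z x < s \<Longrightarrow> dist z y < s \<Longrightarrow> dist (g x) (g y) \<le> M * dist x y"
    using lip_atE[OF assms(2)] by metis
  define F where "F = norm (f z) + L * r"
  define G where "G = norm (g z) + M * s"
  have F: "norm (f x) \<le> F" if "dist z x < r" for x
  proof -
    have "dist (f z) (f x) \<le> L * dist z x" using that f(1) by (intro f(3)) auto
    also have "\<dots> \<le> L * r" using that f(2) by (intro mult_left_mono) auto
    finally show ?thesis
      unfolding F_def dist_norm using norm_triangle_ineq2[of "f x" "f z"] by (simp add: norm_minus_commute)
  qed
  have G: "norm (g x) \<le> G" if "dist z x < s" for x
  proof -
    have "dist (g z) (g x) \<le> M * dist z x" using that g(1) by (intro g(3)) auto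
    also have "\<dots> \<le> M * s" using that g(2) by (intro mult_left_mono) auto
    finally show ?thesis
      unfolding G_def dist_norm using norm_triangle_ineq2[of "g x" "g z"] by (simp add: norm_minus_commute)
  qed
  have nonneg: "0 \<le> F" "0 \<le> G" using f g by (auto simp: F_def G_def)
  show ?thesis
  proof (rule lip_atI[of "min r s" "L * G + F * M"])
    fix x y assume xy: "dist z x < min r s" "dist z y < min r s"
    have "(f x o\<^sub>L g x) - (f y o\<^sub>L g y) = ((f x - f y) o\<^sub>L g x) + (f y o\<^sub>L (g x - g y))"
      by (intro blinfun_eqI) (simp add: blinfun.bilinear_simps)
    then have "dist (f x o\<^sub>L g x) (f y o\<^sub>L g y) \<le> norm ((f x - f y) o\<^sub>L g x) + norm (f y o\<^sub>L (g x - g y))"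
      unfolding dist_norm by (simp add: norm_triangle_ineq)
    also have "\<dots> \<le> norm (f x - f y) * norm (g x) + norm (f y) * norm (g x - g y)"
      by (intro add_mono norm_blinfun_compose)
    also have "\<dots> \<le> (L * dist x y) * G + F * (M * dist x y)"
      using xy f g nonneg by (intro add_mono mult_mono F G) (auto simp flip: dist_norm)
    finally show "dist (f x o\<^sub>L g x) (f y o\<^sub>L g y) \<le> (L * G + F * M) * dist x y"
      by (simp add: algebra_simps)
  qed (use f g nonneg in auto)
qed

text \<open>Derivatives along basis vectors are bounded on a compact ball, hence so is the operator
  norm of the derivative, and the mean value inequality applies on the convex ball.\<close>

lemma lip_at_Ck:
  assumes "Ck_on 1 f S" "open S" "z \<in> S" shows "lip_at f z"
proof -
  obtain f' where f': "\<And>x. x \<in> S \<Longrightarrow> (f has_derivative f' x) (at x)" "\<And>v. continuous_on S (\<lambda>x. f' x v)"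
    using assms(1) by auto
  obtain r where r: "r > 0" "cball z r \<subseteq> S" using assms(2,3) open_contains_cball by blast
  have "\<exists>M. \<forall>x\<in>cball z r. norm (f' x b) \<le> M" for b
  proof -
    have "bounded ((\<lambda>x. f' x b) ` cball z r)"
      by (intro compact_imp_bounded compact_continuous_image compact_cball
          continuous_on_subset[OF f'(2) r(2)])
    then show ?thesis unfolding bounded_iff by blast
  qed
  then obtain M where M: "\<And>b x. x \<in> cball z r \<Longrightarrow> norm (f' x b) \<le> M b" by metis
  define L where "L = (\<Sum>b\<in>Basis. \<bar>M b\<bar>)"
  have onorm: "onorm (f' x) \<le> L" if "x \<in> cball z r" for x
  proof -
    have "bounded_linear (f' x)" using f'(1) that r(2) has_derivative_bounded_linear by blast
    then have "onorm (f' x) \<le> (\<Sum>b\<in>Basis. norm (f' x b))" by (rule onorm_componentwise)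
    also have "\<dots> \<le> L" unfolding L_def using M[OF that] by (intro sum_mono) (meson abs_ge_self order_trans)
    finally show ?thesis .
  qed
  show ?thesis
  proof (rule lip_atI[of r L])
    fix x y assume xy: "dist z x < r" "dist z y < r"
    have "norm (f x - f y) \<le> L * norm (x - y)"
    proof (rule differentiable_bound)
      show "convex (cball z r)" by simp
      show "(f has_derivative f' x) (at x within cball z r)" if "x \<in> cball z r" for x
        using f'(1) that r(2) by (meson has_derivative_at_withinI subsetD)
    qed (use xy onorm in auto)
    then show "dist (f x) (f y) \<le> L * dist x y" by (simp add: dist_norm)
  qed (use r in \<open>auto simp: L_def intro: sum_nonneg\<close>)
qed

section \<open>Lie groups in a chart at the identity\<close>

lemma inv_into_map_prod:
  assumes "inj_on \<phi> U" "inj_on \<psi> V" "a \<in> \<phi> ` U" "b \<in> \<psi> ` V"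
  shows "inv_into (U \<times> V) (map_prod \<phi> \<psi>) (a, b) = (inv_into U \<phi> a, inv_into V \<psi> b)"
proof (rule inv_into_f_eq)
  show "inj_on (map_prod \<phi> \<psi>) (U \<times> V)" using assms(1,2) by (rule map_prod_inj_on)
qed (use assms in \<open>auto simp: inv_into_into f_inv_into_f\<close>)

context lie_group
begin

lemma openin_subset_carrier: "openin T W \<Longrightarrow> W \<subseteq> carrier G"
  using openin_subset topspace_carrier by metis

lemma continuous_map_mult:
  assumes "continuous_map X T f" "continuous_map X T g"
  shows "continuous_map X T (\<lambda>x. f x \<otimes> g x)"
proof -
  have "continuous_map X T ((\<lambda>(x, y). x \<otimes> y) \<circ> (\<lambda>x. (f x, g x)))"
    using smooth_mult assms
    by (intro continuous_map_compose[where X' = "prod_topology T T"] continuous_map_pairedI)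
       (auto simp: smooth_map_def)
  then show ?thesis by (simp add: o_def)
qed

lemma continuous_map_inv:
  assumes "continuous_map X T f" shows "continuous_map X T (\<lambda>x. inv (f x))"
proof -
  have "continuous_map X T ((\<lambda>x. inv x) \<circ> f)"
    using smooth_inv assms by (intro continuous_map_compose[where X' = T]) (auto simp: smooth_map_def)
  then show ?thesis by (simp add: o_def)
qed

lemma continuous_map_const_carrier: "c \<in> carrier G \<Longrightarrow> continuous_map X T (\<lambda>x. c)"
  by (simp add: topspace_carrier)

lemma continuous_map_ident: "continuous_map T T (\<lambda>x. x)"
  by (rule continuous_map_id[unfolded id_def])

lemmas group_continuous_intros = continuous_map_mult continuous_map_inv
  continuous_map_const_carrier continuous_map_ident

text \<open>A connected group is generated by any neighbourhood of the identity. This serves as an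
  induction principle: what holds near the identity and passes to products holds everywhere.\<close>

lemma eq_carrier_if_mult_closed_nhd:
  assumes conn: "connected_space T" and W: "openin T W" "\<one> \<in> W" "W \<subseteq> S"
    and mult: "\<And>x y. x \<in> S \<Longrightarrow> y \<in> S \<Longrightarrow> x \<otimes> y \<in> S" and S: "S \<subseteq> carrier G"
  shows "S = carrier G"
proof -
  \<comment> \<open>\<open>S\<close> is closed under products only; \<open>S'\<close> is a subgroup
    containing the symmetric neighbourhood \<open>W'\<close>.\<close>
  define S' where "S' = {x \<in> S. inv x \<in> S}"
  define W' where "W' = {x \<in> carrier G. x \<in> W \<and> inv x \<in> W}"
  have "openin T ({x \<in> topspace T. x \<in> W} \<inter> {x \<in> topspace T. inv x \<in> W})"
    by (intro openin_Int openin_continuous_map_preimage[OF continuous_map_inv[OF continuous_map_ident]]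
       openin_continuous_map_preimage[OF continuous_map_ident] W)
  then have W': "openin T W'"
    by (rule back_subst) (auto simp: W'_def topspace_carrier)
  have one: "\<one> \<in> S'" using W by (auto simp: S'_def)
  have S'_carrier: "x \<in> carrier G" if "x \<in> S'" for x using that S by (auto simp: S'_def)
  have S'_mult: "x \<otimes> y \<in> S'" "inv x \<otimes> y \<in> S'" if "x \<in> S'" "y \<in> S'" for x y
    using that S'_carrier[OF that(1)] S'_carrier[OF that(2)] mult by (auto simp: S'_def inv_mult_group)
  have W'S': "W' \<subseteq> S'" using W(3) by (auto simp: W'_def S'_def)
  have translate: "openin T {y \<in> carrier G. inv x \<otimes> y \<in> W'}" if "x \<in> carrier G" for x
    using that openin_continuous_map_preimage[OF continuous_map_mult[OF continuous_map_const_carrier[of "inv x"]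
          continuous_map_ident] W'] by (simp add: topspace_carrier)
  have nhd: "x \<in> {y \<in> carrier G. inv x \<otimes> y \<in> W'}" if "x \<in> carrier G" for x
    using that W by (simp add: W'_def)
  \<comment> \<open>Each translate x W' lies in \<open>S'\<close> or misses it, so \<open>S'\<close>
    is both open and closed.\<close>
  have *: "y \<in> S' \<longleftrightarrow> x \<in> S'" if "x \<in> carrier G" "y \<in> carrier G" "inv x \<otimes> y \<in> W'" for x y
  proof
    have in_S': "inv x \<otimes> y \<in> S'" using that W'S' by blast
    assume "x \<in> S'"
    then have "x \<otimes> (inv x \<otimes> y) \<in> S'" using in_S' S'_mult by blast
    then show "y \<in> S'" using that by (simp add: m_assoc[symmetric])
  next
    have "inv x \<otimes> y \<in> S'" using that W'S' by blast
    moreover assume "y \<in> S'"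
    ultimately have "inv (inv x \<otimes> y) \<otimes> one G \<in> S'" "y \<in> S'" using S'_mult(2) one by blast+
    then have "y \<otimes> inv (inv x \<otimes> y) \<in> S'" using that S'_mult by simp
    then show "x \<in> S'" using that by (simp add: inv_mult_group m_assoc[symmetric])
  qed
  have "openin T S'"
  proof (subst openin_subopen, intro ballI)
    fix x assume "x \<in> S'"
    then have "x \<in> carrier G" by (rule S'_carrier)
    moreover have "{y \<in> carrier G. inv x \<otimes> y \<in> W'} \<subseteq> S'"
      using *[OF \<open>x \<in> carrier G\<close>] \<open>x \<in> S'\<close> by blast
    ultimately show "\<exists>U. openin T U \<and> x \<in> U \<and> U \<subseteq> S'"
      using translate nhd by blast
  qed
  moreover have "openin T (carrier G - S')"
  proof (subst openin_subopen, intro ballI)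
    fix x assume "x \<in> carrier G - S'"
    then have "x \<in> carrier G" "x \<notin> S'" by auto
    moreover have "{y \<in> carrier G. inv x \<otimes> y \<in> W'} \<subseteq> carrier G - S'"
      using *[OF \<open>x \<in> carrier G\<close>] \<open>x \<notin> S'\<close> by blast
    ultimately show "\<exists>U. openin T U \<and> x \<in> U \<and> U \<subseteq> carrier G - S'"
      using translate nhd by blast
  qed
  then have "closedin T S'"
    using S'_carrier unfolding closedin_def topspace_carrier by blast
  ultimately have "S' = {} \<or> S' = carrier G"
    using conn unfolding connected_space_clopen_in topspace_carrier by blast
  then show ?thesis using one S by (auto simp: S'_def)
qed

end

text \<open>All calculus takes place in one chart at the identity; the rest of the group is reached
  by translation and by \<open>eq_carrier_if_mult_closed_nhd\<close>.\<close>

locale lie_group_chart = lie_group +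
  fixes U \<psi>
  assumes chart: "(U, \<psi>) \<in> A" and one_in: "\<one> \<in> U"
begin

definition \<xi> where "\<xi> = inv_into U \<psi>"
definition V where "V = \<psi> ` U"
definition p where "p = \<psi> \<one>"
definition m where "m = (\<lambda>(a, b). \<psi> (\<xi> a \<otimes> \<xi> b))"
definition i where "i a = \<psi> (inv \<xi> a)"
definition \<Omega> where "\<Omega> = {(a, b). a \<in> V \<and> b \<in> V \<and> \<xi> a \<otimes> \<xi> b \<in> U}"
definition \<Omega>i where "\<Omega>i = {a \<in> V. inv \<xi> a \<in> U}"

lemma openin_U: "openin T U" and open_V: "open V"
  and homeo: "homeomorphic_map (subtopology T U) (top_of_set V) \<psi>"
  using charts[OF chart] by (auto simp: is_chart_def V_def)

lemma U_carrier: "x \<in> U \<Longrightarrow> x \<in> carrier G"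
  using openin_subset_carrier[OF openin_U] by blast

lemma topspace_U: "topspace (subtopology T U) = U"
  using U_carrier topspace_carrier by auto

lemma inj: "inj_on \<psi> U"
  using homeo topspace_U by (metis homeomorphic_imp_injective_map)

lemma \<xi>_\<psi> [simp]: "x \<in> U \<Longrightarrow> \<xi> (\<psi> x) = x"
  unfolding \<xi>_def using inj by simp

lemma \<psi>_\<xi> [simp]: "a \<in> V \<Longrightarrow> \<psi> (\<xi> a) = a"
  unfolding \<xi>_def V_def by (rule f_inv_into_f)

lemma \<psi>_in [simp]: "x \<in> U \<Longrightarrow> \<psi> x \<in> V"
  by (simp add: V_def)

lemma \<xi>_in [simp]: "a \<in> V \<Longrightarrow> \<xi> a \<in> U"
  by (auto simp: V_def)

lemma \<xi>_carrier [simp]: "a \<in> V \<Longrightarrow> \<xi> a \<in> carrier G"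
  by (simp add: U_carrier)

lemma p_in [simp]: "p \<in> V" and \<xi>_p [simp]: "\<xi> p = \<one>"
  using one_in by (simp_all add: p_def)

lemma continuous_\<xi>: "continuous_map (top_of_set V) T \<xi>"
proof -
  obtain g where hom: "homeomorphic_maps (subtopology T U) (top_of_set V) \<psi> g"
    using homeo homeomorphic_map_maps by blast
  then have g: "continuous_map (top_of_set V) (subtopology T U) g"
    by (simp add: homeomorphic_maps_def)
  have "g a = \<xi> a" if "a \<in> V" for a
  proof -
    have "g a \<in> U"
      using continuous_map_image_subset_topspace[OF g] topspace_U that by auto
    moreover have "\<psi> (g a) = a" using hom that by (simp add: homeomorphic_maps_def)
    ultimately show ?thesis by (metis \<xi>_\<psi>)
  qed
  then show ?thesis
    using continuous_map_eq[of "top_of_set V" T g \<xi>] g by (simp add: continuous_map_in_subtopology)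
qed

lemma open_chart_preimage:
  assumes "continuous_map T T F" "openin T W" shows "open {a \<in> V. F (\<xi> a) \<in> W}"
proof -
  have "openin (top_of_set V) {a \<in> topspace (top_of_set V). (F \<circ> \<xi>) a \<in> W}"
    by (intro openin_continuous_map_preimage[OF _ assms(2)] continuous_map_compose[OF continuous_\<xi> assms(1)])
  then show ?thesis using open_V by (simp add: openin_open_eq Int_absorb1 subset_eq)
qed

lemma openin_chart_image:
  assumes "open B" shows "openin T {x \<in> U. \<psi> x \<in> B}"
proof -
  have "continuous_map (subtopology T U) euclidean \<psi>"
    using homeomorphic_imp_continuous_map[OF homeo] continuous_map_in_subtopology by blast
  then have "openin (subtopology T U) {x \<in> topspace (subtopology T U). \<psi> x \<in> B}"
    by (rule openin_continuous_map_preimage) (simp add: assms)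
  then show ?thesis
    unfolding topspace_U openin_open_subtopology[OF openin_U] by simp
qed

lemma open_\<Omega>: "open \<Omega>"
proof -
  have "continuous_map (top_of_set (V \<times> V)) T (\<lambda>z. \<xi> (fst z) \<otimes> \<xi> (snd z))"
  proof (rule continuous_map_mult)
    have "continuous_map (top_of_set (V \<times> V)) (top_of_set V) fst"
      "continuous_map (top_of_set (V \<times> V)) (top_of_set V) snd"
      by (auto intro!: continuous_intros)
    from this[THEN continuous_map_compose, OF continuous_\<xi>]
    show "continuous_map (top_of_set (V \<times> V)) T (\<lambda>z. \<xi> (fst z))"
      "continuous_map (top_of_set (V \<times> V)) T (\<lambda>z. \<xi> (snd z))"
      unfolding o_def by blast+
  qed
  from openin_continuous_map_preimage[OF this openin_U]
  have "open {z \<in> V \<times> V. \<xi> (fst z) \<otimes> \<xi> (snd z) \<in> U}"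
    using open_Times[OF open_V open_V] by (simp add: openin_open_eq)
  moreover have "{z \<in> V \<times> V. \<xi> (fst z) \<otimes> \<xi> (snd z) \<in> U} = \<Omega>" by (auto simp: \<Omega>_def)
  ultimately show ?thesis by simp
qed

lemma open_\<Omega>i: "open \<Omega>i"
  unfolding \<Omega>i_def by (rule open_chart_preimage[OF continuous_map_inv[OF continuous_map_ident] openin_U])

text \<open>Two orders of differentiability are extracted: \<open>Ad\<close> is expressed by the
  first derivative of multiplication, and its Lipschitz bound needs that derivative to be
  C^1.\<close>

lemma smooth_m: "\<exists>m'. (\<forall>z\<in>\<Omega>. (m has_derivative m' z) (at z)) \<and> (\<forall>v. Ck_on 1 (\<lambda>z. m' z v) \<Omega>)"
proof -
  let ?f = "\<psi> \<circ> (\<lambda>(x, y). x \<otimes> y) \<circ> inv_into (U \<times> U) (map_prod \<psi> \<psi>)"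
  have "(U \<times> U, map_prod \<psi> \<psi>) \<in> prod_atlas A A"
    using chart unfolding prod_atlas_def by blast
  then have "smooth_on ?f (map_prod \<psi> \<psi> ` {x \<in> U \<times> U. (case x of (x, y) \<Rightarrow> x \<otimes> y) \<in> U})"
    using smooth_mult chart unfolding smooth_map_def by fastforce
  moreover have "map_prod \<psi> \<psi> ` {x \<in> U \<times> U. (case x of (x, y) \<Rightarrow> x \<otimes> y) \<in> U} = \<Omega>"
  proof (intro subset_antisym subsetI)
    fix z assume "z \<in> \<Omega>"
    then show "z \<in> map_prod \<psi> \<psi> ` {x \<in> U \<times> U. (case x of (x, y) \<Rightarrow> x \<otimes> y) \<in> U}"
      by (intro image_eqI[of _ _ "map_prod \<xi> \<xi> z"]) (auto simp: \<Omega>_def)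
  qed (auto simp: \<Omega>_def)
  ultimately have "Ck_on 2 ?f \<Omega>" by (simp add: smooth_on_def)
  then obtain m' where m': "\<And>z. z \<in> \<Omega> \<Longrightarrow> (?f has_derivative m' z) (at z)"
      "\<And>v. Ck_on 1 (\<lambda>z. m' z v) \<Omega>"
    by (auto simp: numeral_2_eq_2)
  have "?f z = m z" if "z \<in> \<Omega>" for z
    using that inv_into_map_prod[OF inj inj, of "fst z" "snd z"]
    by (auto simp: \<Omega>_def m_def \<xi>_def V_def)
  then have "(m has_derivative m' z) (at z)" if "z \<in> \<Omega>" for z
    using m'(1)[OF that] open_\<Omega> that by (rule has_derivative_transform_within_open[rotated 3]) auto
  then show ?thesis using m'(2) by blast
qed

definition m' where "m' = (SOME m'. (\<forall>z\<in>\<Omega>. (m has_derivative m' z) (at z)) \<and> (\<forall>v. Ck_on 1 (\<lambda>z. m' z v) \<Omega>))"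

lemma m_deriv: "z \<in> \<Omega> \<Longrightarrow> (m has_derivative m' z) (at z)"
  and m'_Ck: "Ck_on 1 (\<lambda>z. m' z v) \<Omega>"
  using someI_ex[OF smooth_m] unfolding m'_def by blast+

lemma Ck_i: "Ck_on 1 i \<Omega>i"
proof -
  let ?f = "\<psi> \<circ> (\<lambda>x. inv x) \<circ> inv_into U \<psi>"
  have "smooth_on ?f (\<psi> ` {x \<in> U. inv x \<in> U})"
    using smooth_inv chart unfolding smooth_map_def by fastforce
  moreover have "\<psi> ` {x \<in> U. inv x \<in> U} = \<Omega>i"
    by (force simp: \<Omega>i_def V_def)
  moreover have "?f = i" by (rule ext) (simp add: i_def \<xi>_def)
  ultimately show ?thesis by (simp add: smooth_on_def)
qed

lemma i_deriv: "a \<in> \<Omega>i \<Longrightarrow> \<exists>i'. (i has_derivative i') (at a)"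
  using Ck_i by auto

lemma p_in_\<Omega>i [simp]: "p \<in> \<Omega>i" and i_p [simp]: "i p = p"
  using one_in by (auto simp: \<Omega>i_def i_def p_def)

lemma \<Omega>_p_right [simp]: "a \<in> V \<Longrightarrow> (a, p) \<in> \<Omega>"
  and \<Omega>_p_left [simp]: "a \<in> V \<Longrightarrow> (p, a) \<in> \<Omega>"
  by (auto simp: \<Omega>_def)

lemma m_p_right [simp]: "a \<in> V \<Longrightarrow> m (a, p) = a"
  by (simp add: m_def)

lemma \<xi>_m: "(a, b) \<in> \<Omega> \<Longrightarrow> \<xi> (m (a, b)) = \<xi> a \<otimes> \<xi> b"
  by (simp add: \<Omega>_def m_def)

lemma i_in: "a \<in> \<Omega>i \<Longrightarrow> i a \<in> V" and \<xi>_i: "a \<in> \<Omega>i \<Longrightarrow> \<xi> (i a) = inv \<xi> a"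
  by (simp_all add: \<Omega>i_def i_def)

lemma \<Omega>_i_right [simp]: "a \<in> \<Omega>i \<Longrightarrow> (a, i a) \<in> \<Omega>"
  and \<Omega>_i_left [simp]: "a \<in> \<Omega>i \<Longrightarrow> (i a, a) \<in> \<Omega>"
  using one_in by (auto simp: \<Omega>_def \<Omega>i_def i_def)

end

section \<open>The adjoint representation\<close>

definition conjugate where "conjugate G g x = g \<otimes>\<^bsub>G\<^esub> x \<otimes>\<^bsub>G\<^esub> inv\<^bsub>G\<^esub> g"

context lie_group
begin

abbreviation conj_by where "conj_by \<equiv> conjugate G"

lemma conj_by_carrier [simp]: "g \<in> carrier G \<Longrightarrow> x \<in> carrier G \<Longrightarrow> conj_by g x \<in> carrier G"
  by (simp add: conjugate_def)

lemma conj_by_one [simp]: "g \<in> carrier G \<Longrightarrow> conj_by g \<one> = \<one>"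
  by (simp add: conjugate_def)

lemma conj_by_mult:
  "\<lbrakk>g \<in> carrier G; h \<in> carrier G; x \<in> carrier G\<rbrakk> \<Longrightarrow> conj_by (g \<otimes> h) x = conj_by g (conj_by h x)"
  by (simp add: conjugate_def inv_mult_group m_assoc)

lemma continuous_map_conj_by: "g \<in> carrier G \<Longrightarrow> continuous_map T T (conj_by g)"
  unfolding conjugate_def by (intro group_continuous_intros) auto

end

context lie_group_chart
begin

text \<open>A relation, because the derivative of the chart expression is first known to exist only
  for g near the identity and is then spread over the group by products.\<close>

definition has_ad where
  "has_ad g L \<longleftrightarrow> ((\<lambda>b. \<psi> (conj_by g (\<xi> b))) has_derivative L) (at p)"

text \<open>The chain rule for b \<mapsto> m (m (a, b), i a), which is conjugation in the chart. The
  explicit formula shows how the derivative depends on a.\<close>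

lemma has_ad_chart:
  assumes a: "a \<in> \<Omega>i"
  shows "has_ad (\<xi> a) (\<lambda>v. m' (a, i a) (m' (a, p) (0, v), 0))"
proof -
  have aV: "a \<in> V" using a by (simp add: \<Omega>i_def)
  have "((\<lambda>b. (a, b)) has_derivative (\<lambda>v. (0, v))) (at p)"
    by (auto intro!: derivative_eq_intros)
  from has_derivative_compose[OF this m_deriv[OF \<Omega>_p_right[OF aV]]]
  have "((\<lambda>b. (m (a, b), i a)) has_derivative (\<lambda>v. (m' (a, p) (0, v), 0))) (at p)"
    by (auto intro!: derivative_eq_intros)
  from has_derivative_compose[OF this, of m] m_deriv[OF \<Omega>_i_right[OF a]] aV
  have "((\<lambda>b. m (m (a, b), i a)) has_derivative (\<lambda>v. m' (a, i a) (m' (a, p) (0, v), 0))) (at p)"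
    by simp
  then show ?thesis
    unfolding has_ad_def
  proof (rule has_derivative_transform_within_open)
    show "open {b \<in> V. \<xi> a \<otimes> \<xi> b \<in> U}"
      using aV by (intro open_chart_preimage[OF _ openin_U] group_continuous_intros) simp
    show "p \<in> {b \<in> V. \<xi> a \<otimes> \<xi> b \<in> U}" using aV by simp
    fix b assume "b \<in> {b \<in> V. \<xi> a \<otimes> \<xi> b \<in> U}"
    then have "(a, b) \<in> \<Omega>" using aV by (simp add: \<Omega>_def)
    then show "m (m (a, b), i a) = \<psi> (conj_by (\<xi> a) (\<xi> b))"
      using \<xi>_i[OF a] \<xi>_m by (simp add: m_def[of] conjugate_def)
  qed
qed

lemma has_ad_mult:
  assumes gh: "g \<in> carrier G" "h \<in> carrier G" and L: "has_ad g L" "has_ad h L'"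
  shows "has_ad (g \<otimes> h) (\<lambda>v. L (L' v))"
proof -
  have "\<psi> (conj_by h (\<xi> p)) = p" using gh by (simp, simp add: p_def)
  then have "((\<lambda>b. \<psi> (conj_by g (\<xi> (\<psi> (conj_by h (\<xi> b)))))) has_derivative (\<lambda>v. L (L' v))) (at p)"
    using has_derivative_compose[OF L(2)[unfolded has_ad_def], of _ L] L(1) by (simp add: has_ad_def)
  then show ?thesis
    unfolding has_ad_def
  proof (rule has_derivative_transform_within_open)
    show "open {b \<in> V. conj_by h (\<xi> b) \<in> U}"
      using gh by (intro open_chart_preimage[OF _ openin_U] continuous_map_conj_by)
    show "p \<in> {b \<in> V. conj_by h (\<xi> b) \<in> U}" using gh one_in by simp
    fix b assume "b \<in> {b \<in> V. conj_by h (\<xi> b) \<in> U}"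
    then show "\<psi> (conj_by g (\<xi> (\<psi> (conj_by h (\<xi> b))))) = \<psi> (conj_by (g \<otimes> h) (\<xi> b))"
      using gh by (simp add: conj_by_mult)
  qed
qed

lemma has_ad_one: "has_ad \<one> (\<lambda>v. v)"
  unfolding has_ad_def
  by (rule has_derivative_transform_within_open[OF has_derivative_ident open_V p_in])
     (simp add: conjugate_def)

lemma chart_nhd: "openin T {x \<in> U. \<psi> x \<in> B}" "\<one> \<in> {x \<in> U. \<psi> x \<in> B}" if "open B" "p \<in> B"
  using that openin_chart_image one_in by (auto simp: p_def)

end

locale connected_lie_group_chart = lie_group_chart +
  assumes connected: "connected_space T"
begin

text \<open>\<open>has_ad_chart\<close> covers a neighbourhood of the identity,
  \<open>has_ad_mult\<close> gives closure under products, and connectedness does the rest.\<close>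

lemma ex_has_ad: "g \<in> carrier G \<Longrightarrow> \<exists>L. has_ad g L"
proof -
  have "{g \<in> carrier G. \<exists>L. has_ad g L} = carrier G"
  proof (rule eq_carrier_if_mult_closed_nhd[OF connected chart_nhd[OF open_\<Omega>i p_in_\<Omega>i]])
    show "{x \<in> U. \<psi> x \<in> \<Omega>i} \<subseteq> {g \<in> carrier G. \<exists>L. has_ad g L}"
    proof
      fix x assume "x \<in> {x \<in> U. \<psi> x \<in> \<Omega>i}"
      then show "x \<in> {g \<in> carrier G. \<exists>L. has_ad g L}"
        using has_ad_chart[of "\<psi> x"] U_carrier by auto
    qed
    fix x y assume "x \<in> {g \<in> carrier G. \<exists>L. has_ad g L}" "y \<in> {g \<in> carrier G. \<exists>L. has_ad g L}"
    then show "x \<otimes> y \<in> {g \<in> carrier G. \<exists>L. has_ad g L}"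
      using has_ad_mult by blast
  qed auto
  then show "g \<in> carrier G \<Longrightarrow> \<exists>L. has_ad g L" by blast
qed

definition Ad where "Ad g = Blinfun (SOME L. has_ad g L)"

lemma Ad: "g \<in> carrier G \<Longrightarrow> has_ad g (blinfun_apply (Ad g))"
proof -
  assume "g \<in> carrier G"
  then have L: "has_ad g (SOME L. has_ad g L)" by (rule someI_ex[OF ex_has_ad])
  then have "bounded_linear (SOME L. has_ad g L)"
    unfolding has_ad_def by (rule has_derivative_bounded_linear)
  then show "has_ad g (blinfun_apply (Ad g))"
    using L unfolding Ad_def by (subst bounded_linear_Blinfun_apply)
qed

lemma Ad_unique: "g \<in> carrier G \<Longrightarrow> has_ad g L \<Longrightarrow> Ad g v = L v"
  using has_derivative_unique[OF Ad[unfolded has_ad_def], of g L] by (simp add: has_ad_def)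

lemma Ad_mult: "g \<in> carrier G \<Longrightarrow> h \<in> carrier G \<Longrightarrow> Ad (g \<otimes> h) = Ad g o\<^sub>L Ad h"
  by (rule blinfun_eqI) (simp add: Ad_unique[OF _ has_ad_mult[OF _ _ Ad Ad]])

lemma Ad_one: "Ad \<one> = id_blinfun"
  by (rule blinfun_eqI) (simp add: Ad_unique[OF _ has_ad_one])

lemma Ad_inv:
  assumes "g \<in> carrier G"
  shows "Ad (inv g) o\<^sub>L Ad g = id_blinfun" "Ad g o\<^sub>L Ad (inv g) = id_blinfun"
  using assms by (simp_all flip: Ad_mult add: Ad_one)

lemma lip_at_m': "a \<in> \<Omega> \<Longrightarrow> lip_at f z \<Longrightarrow> f z = a \<Longrightarrow> lip_at (\<lambda>x. m' (f x) v) z"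
  using lip_at_compose[of f z "\<lambda>a. m' a v"] lip_at_Ck[OF m'_Ck open_\<Omega>] by blast

lemma bounded_linear_m': "z \<in> \<Omega> \<Longrightarrow> bounded_linear (m' z)"
  using m_deriv has_derivative_bounded_linear by blast

text \<open>\<open>Ad\<close> is a composite of two partial derivatives of \<open>m\<close>, at (a,
  i a) and at (a, p); each is a C^1 function evaluated along a Lipschitz curve of arguments.\<close>

lemma lip_at_Ad: "lip_at (\<lambda>a. Ad (\<xi> a)) p"
proof -
  define X where "X a = Blinfun (\<lambda>w. m' (a, i a) (w, 0))" for a
  define Y where "Y a = Blinfun (\<lambda>v. m' (a, p) (0, v))" for a
  have X: "blinfun_apply (X a) = (\<lambda>w. m' (a, i a) (w, 0))" if "a \<in> \<Omega>i" for a
    unfolding X_def using that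
    by (intro bounded_linear_Blinfun_apply bounded_linear_compose[OF bounded_linear_m'] bounded_linear_intros) auto
  have Y: "blinfun_apply (Y a) = (\<lambda>v. m' (a, p) (0, v))" if "a \<in> \<Omega>i" for a
    unfolding Y_def using that
    by (intro bounded_linear_Blinfun_apply bounded_linear_compose[OF bounded_linear_m'] bounded_linear_intros)
       (auto simp: \<Omega>i_def)
  \<comment> \<open>The formulas for \<open>X\<close>, \<open>Y\<close> and \<open>Ad\<close> hold
    only on \<open>\<Omega>i\<close>; shrinking the ball is harmless, since \<open>lip_at\<close> is
    local.\<close>
  have transfer: "lip_at f p" if g: "lip_at g p" and eq: "\<And>a. a \<in> \<Omega>i \<Longrightarrow> f a = g a" for f g :: "_ \<Rightarrow> 'x::metric_space"
  proof -
    obtain r L where r: "r > 0" "0 \<le> L" "\<And>x y. dist p x < r \<Longrightarrow> dist p y < r \<Longrightarrow> dist (g x) (g y) \<le> L * dist x y"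
      using lip_atE[OF g] by metis
    obtain s where s: "s > 0" "ball p s \<subseteq> \<Omega>i" using open_\<Omega>i p_in_\<Omega>i open_contains_ball by blast
    show ?thesis
    proof (rule lip_atI[of "min r s" L])
      fix x y assume xy: "dist p x < min r s" "dist p y < min r s"
      then have "x \<in> \<Omega>i" "y \<in> \<Omega>i" using s(2) by auto
      then show "dist (f x) (f y) \<le> L * dist x y" using r(3) xy by (simp add: eq)
    qed (use r s in auto)
  qed
  have i: "lip_at i p" by (rule lip_at_Ck[OF Ck_i open_\<Omega>i p_in_\<Omega>i])
  have "lip_at X p"
  proof (rule lip_at_blinfun, rule transfer)
    fix b show "lip_at (\<lambda>a. m' (a, i a) (b, 0)) p"
      by (rule lip_at_m'[OF \<Omega>_p_right[OF p_in]]) (auto intro!: lip_at_Pair lip_at_ident i)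
  qed (simp add: X)
  moreover have "lip_at Y p"
  proof (rule lip_at_blinfun, rule transfer)
    fix b show "lip_at (\<lambda>a. m' (a, p) (0, b)) p"
      by (rule lip_at_m'[OF \<Omega>_p_right[OF p_in]]) (auto intro!: lip_at_Pair lip_at_ident lip_at_const)
  qed (simp add: Y)
  ultimately have "lip_at (\<lambda>a. X a o\<^sub>L Y a) p" by (rule lip_at_blinfun_compose)
  then show ?thesis
  proof (rule transfer)
    fix a assume a: "a \<in> \<Omega>i"
    then have "a \<in> V" by (simp add: \<Omega>i_def)
    then show "Ad (\<xi> a) = X a o\<^sub>L Y a"
      by (intro blinfun_eqI) (simp add: X[OF a] Y[OF a] Ad_unique[OF _ has_ad_chart[OF a]])
  qed
qed

text \<open>At the identity this is the Lipschitz bound; elsewhere Ad x = Ad g o Ad (g^-1 x) moves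
  the question to the identity.\<close>

lemma continuous_map_Ad: "continuous_map T euclidean Ad"
proof -
  have near: "\<exists>W. openin T W \<and> \<one> \<in> W \<and> (\<forall>x\<in>W. dist id_blinfun (Ad x) < \<epsilon>)" if "\<epsilon> > 0" for \<epsilon>
  proof -
    obtain r L where r: "r > 0" "0 \<le> L"
        "\<And>x y. dist p x < r \<Longrightarrow> dist p y < r \<Longrightarrow> dist (Ad (\<xi> x)) (Ad (\<xi> y)) \<le> L * dist x y"
      using lip_atE[OF lip_at_Ad] by metis
    define s where "s = min r (\<epsilon> / (L + 1))"
    have s: "s > 0" using r \<open>\<epsilon> > 0\<close> by (simp add: s_def)
    have "dist id_blinfun (Ad x) < \<epsilon>" if "x \<in> {x \<in> U. \<psi> x \<in> ball p s}" for x
    proof -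
      have x: "x \<in> U" "dist p (\<psi> x) < r" "dist p (\<psi> x) < \<epsilon> / (L + 1)" using that by (auto simp: s_def)
      have "dist (Ad (\<xi> p)) (Ad (\<xi> (\<psi> x))) \<le> L * dist p (\<psi> x)" using x r by (intro r(3)) auto
      also have "\<dots> \<le> (L + 1) * dist p (\<psi> x)" by (simp add: algebra_simps)
      also have "\<dots> < \<epsilon>" using x r(2) by (simp add: field_simps)
      finally show ?thesis using x by (simp add: Ad_one)
    qed
    then show ?thesis using chart_nhd[of "ball p s"] s by (intro exI[of _ "{x \<in> U. \<psi> x \<in> ball p s}"]) auto
  qed
  have "openin T {x \<in> topspace T. Ad x \<in> B}" if "open B" for B
  proof (subst openin_subopen, intro ballI)
    fix g assume "g \<in> {x \<in> topspace T. Ad x \<in> B}"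
    then have g: "g \<in> carrier G" "Ad g \<in> B" by (auto simp: topspace_carrier)
    obtain e where e: "e > 0" "ball (Ad g) e \<subseteq> B" using \<open>open B\<close> g open_contains_ball by blast
    define \<epsilon> where "\<epsilon> = e / (norm (Ad g) + 1)"
    have "\<epsilon> > 0" using e by (simp add: \<epsilon>_def add_nonneg_pos)
    from near[OF this] obtain W where W: "openin T W" "\<one> \<in> W" "\<And>x. x \<in> W \<Longrightarrow> dist id_blinfun (Ad x) < \<epsilon>"
      by metis
    have "openin T {x \<in> topspace T. inv g \<otimes> x \<in> W}"
      using g by (intro openin_continuous_map_preimage[OF _ W(1)] group_continuous_intros) auto
    moreover have "g \<in> {x \<in> topspace T. inv g \<otimes> x \<in> W}" using g W by (simp add: topspace_carrier)
    moreover have "{x \<in> topspace T. inv g \<otimes> x \<in> W} \<subseteq> {x \<in> topspace T. Ad x \<in> B}"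
    proof
      fix x assume "x \<in> {x \<in> topspace T. inv g \<otimes> x \<in> W}"
      then have x: "x \<in> carrier G" "inv g \<otimes> x \<in> W" by (auto simp: topspace_carrier)
      have "Ad x = Ad (g \<otimes> (inv g \<otimes> x))" using x g by (simp add: m_assoc[symmetric])
      also have "\<dots> = Ad g o\<^sub>L Ad (inv g \<otimes> x)" using x g by (simp add: Ad_mult)
      finally have "Ad g - Ad x = Ad g o\<^sub>L (id_blinfun - Ad (inv g \<otimes> x))"
        by (intro blinfun_eqI) (simp add: blinfun.bilinear_simps)
      then have "dist (Ad g) (Ad x) \<le> norm (Ad g) * dist id_blinfun (Ad (inv g \<otimes> x))"
        unfolding dist_norm by (metis norm_blinfun_compose)
      also have "\<dots> \<le> (norm (Ad g) + 1) * dist id_blinfun (Ad (inv g \<otimes> x))"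
        by (intro mult_right_mono) auto
      also have "\<dots> < (norm (Ad g) + 1) * \<epsilon>"
        using W(3)[OF x(2)] by (intro mult_strict_left_mono) (auto intro: add_nonneg_pos)
      also have "\<dots> = e" unfolding \<epsilon>_def by (simp add: add_nonneg_eq_0_iff)
      finally show "x \<in> {x \<in> topspace T. Ad x \<in> B}" using e(2) x by (auto simp: topspace_carrier)
    qed
    ultimately show "\<exists>W. openin T W \<and> g \<in> W \<and> W \<subseteq> {x \<in> topspace T. Ad x \<in> B}" by blast
  qed
  then show ?thesis by (auto simp: continuous_map_def)
qed

text \<open>
  The derivative of \<open>x \<mapsto> g x g\<inverse> x\<inverse>\<close> vanishes at the identity when \<open>g\<close> acts trivially, and
  hence, by translation, everywhere near the identity.
\<close>

lemma central_if_Ad_trivial: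
  assumes g: "g \<in> carrier G" and triv: "Ad g = id_blinfun" and x: "x \<in> carrier G"
  shows "g \<otimes> x = x \<otimes> g"
proof -
  define f where "f = conj_by g"
  have f_carrier [simp]: "x \<in> carrier G \<Longrightarrow> f x \<in> carrier G" and f_one [simp]: "f \<one> = \<one>" for x
    using g by (simp_all add: f_def)
  have cont_f: "continuous_map T T f" unfolding f_def by (rule continuous_map_conj_by[OF g])
  have cont_f': "continuous_map X T (\<lambda>x. f (h x))" if "continuous_map X T h" for X :: "'y topology" and h
    using continuous_map_compose[OF that cont_f] by (simp add: o_def)
  have f_deriv: "((\<lambda>b. \<psi> (f (\<xi> b))) has_derivative (\<lambda>v. v)) (at p)"
    using Ad[OF g] by (simp add: has_ad_def f_def triv id_blinfun.rep_eq)
  obtain i' where i': "(i has_derivative i') (at p)" using i_deriv[OF p_in_\<Omega>i] by blast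
  have m'_i': "m' (p, p) (v, i' v) = 0" for v
  proof -
    have "((\<lambda>b. (b, i b)) has_derivative (\<lambda>v. (v, i' v))) (at p)"
      by (intro has_derivative_Pair has_derivative_ident i')
    from has_derivative_compose[OF this, of m "m' (p, p)"]
    have "((\<lambda>b. m (b, i b)) has_derivative (\<lambda>v. m' (p, p) (v, i' v))) (at p)"
      using m_deriv[OF \<Omega>_p_right[OF p_in]] by simp
    moreover have "((\<lambda>b. m (b, i b)) has_derivative (\<lambda>v. 0)) (at p)"
      using has_derivative_const open_\<Omega>i p_in_\<Omega>i
    proof (rule has_derivative_transform_within_open)
      fix b assume "b \<in> \<Omega>i"
      then show "p = m (b, i b)" using \<xi>_i[of b] by (simp add: m_def p_def \<Omega>i_def)
    qed
    ultimately show ?thesis by (rule fun_cong[OF has_derivative_unique])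
  qed
  \<comment> \<open>To first order f is the identity at \<open>p\<close>, so f(b) b^-1 has the same
    derivative there as the constant b b^-1, namely 0.\<close>
  have H: "((\<lambda>b. m (\<psi> (f (\<xi> b)), i b)) has_derivative (\<lambda>v. 0)) (at p)"
  proof -
    have "((\<lambda>b. (\<psi> (f (\<xi> b)), i b)) has_derivative (\<lambda>v. (v, i' v))) (at p)"
      by (intro has_derivative_Pair f_deriv i')
    from has_derivative_compose[OF this, of m "m' (p, p)"] m_deriv[OF \<Omega>_p_right[OF p_in]]
    show ?thesis by (simp add: m'_i' p_def[symmetric])
  qed
  define N where "N = {a \<in> V. \<xi> a \<in> {x \<in> carrier G. inv x \<in> U \<and> f x \<in> U \<and> f x \<otimes> inv x \<in> U}}"
  have "openin T ({x \<in> topspace T. inv x \<in> U} \<inter> {x \<in> topspace T. f x \<in> U} \<inter> {x \<in> topspace T. f x \<otimes> inv x \<in> U})"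
    by (intro openin_Int openin_continuous_map_preimage[OF _ openin_U] group_continuous_intros cont_f')
  then have "openin T {x \<in> carrier G. inv x \<in> U \<and> f x \<in> U \<and> f x \<otimes> inv x \<in> U}"
    by (rule back_subst) (auto simp: topspace_carrier)
  then have "open N" unfolding N_def by (intro open_chart_preimage continuous_map_ident)
  moreover have "p \<in> N" using one_in by (simp add: N_def)
  ultimately obtain r where r: "r > 0" "ball p r \<subseteq> N" using open_contains_ball by blast
  define \<Delta> where "\<Delta> a = \<psi> (f (\<xi> a) \<otimes> inv \<xi> a)" for a
  \<comment> \<open>Translation to the identity: for x' = x k, f(x') x'^-1 = f(x) (f(k) k^-1) x^-1,
    and the middle factor has zero derivative at k = 1 by \<open>H\<close>.\<close>
  have \<Delta>_deriv: "(\<Delta> has_derivative (\<lambda>v. 0)) (at a)" if "a \<in> N" for a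
  proof -
    define x where "x = \<xi> a"
    define \<alpha> where "\<alpha> = \<psi> (f x)"
    have aV: "a \<in> V" and xc: "x \<in> carrier G" and xU: "inv x \<in> U" "f x \<in> U" "f x \<otimes> inv x \<in> U"
      using that by (auto simp: N_def x_def)
    have a\<Omega>: "a \<in> \<Omega>i" using aV xU by (simp add: \<Omega>i_def x_def)
    have \<alpha>: "\<alpha> \<in> V" "\<xi> \<alpha> = f x" using xU by (simp_all add: \<alpha>_def)
    have \<xi>ia: "\<xi> (i a) = inv x" using \<xi>_i[OF a\<Omega>] by (simp add: x_def)
    have iaV: "i a \<in> V" using i_in[OF a\<Omega>] .
    have mia: "m (i a, a) = p" using \<xi>ia xc by (simp add: m_def p_def flip: x_def)
    have "((\<lambda>a'. (i a, a')) has_derivative (\<lambda>v. (0, v))) (at a)"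
      by (intro has_derivative_Pair has_derivative_ident has_derivative_const)
    from has_derivative_compose[OF this m_deriv[OF \<Omega>_i_left[OF a\<Omega>]]]
    have 1: "((\<lambda>a'. m (i a, a')) has_derivative (\<lambda>v. m' (i a, a) (0, v))) (at a)" .
    from has_derivative_compose[OF this, of "\<lambda>b. m (\<psi> (f (\<xi> b)), i b)" "\<lambda>v. 0"] H mia
    have 2: "((\<lambda>a'. m (\<psi> (f (\<xi> (m (i a, a')))), i (m (i a, a')))) has_derivative (\<lambda>v. 0)) (at a)"
      by simp
    have "((\<lambda>d. (\<alpha>, d)) has_derivative (\<lambda>v. (0, v))) (at p)"
      by (intro has_derivative_Pair has_derivative_ident has_derivative_const)
    from has_derivative_compose[OF this m_deriv[OF \<Omega>_p_right[OF \<alpha>(1)]]]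
    have "((\<lambda>d. (m (\<alpha>, d), i a)) has_derivative (\<lambda>v. (m' (\<alpha>, p) (0, v), 0))) (at p)"
      by (intro has_derivative_Pair has_derivative_const)
    moreover have "(\<alpha>, i a) \<in> \<Omega>" using \<alpha> iaV \<xi>ia xU by (simp add: \<Omega>_def)
    ultimately have 3: "((\<lambda>d. m (m (\<alpha>, d), i a)) has_derivative (\<lambda>v. m' (\<alpha>, i a) (m' (\<alpha>, p) (0, v), 0))) (at p)"
      using has_derivative_compose[of "\<lambda>d. (m (\<alpha>, d), i a)" _ p UNIV m "m' (\<alpha>, i a)"] m_deriv \<alpha>(1) by simp
    have "m (\<psi> (f (\<xi> (m (i a, a)))), i (m (i a, a))) = p"
      using mia by (simp add: p_def[symmetric] m_p_right)
    with has_derivative_compose[OF 2, of "\<lambda>d. m (m (\<alpha>, d), i a)"] 3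
    have "((\<lambda>a'. m (m (\<alpha>, m (\<psi> (f (\<xi> (m (i a, a')))), i (m (i a, a')))), i a)) has_derivative
        (\<lambda>v. m' (\<alpha>, i a) (m' (\<alpha>, p) (0, 0), 0))) (at a)"
      by simp
    moreover have "m' (\<alpha>, i a) (m' (\<alpha>, p) (0, 0), 0) = 0"
      using \<open>(\<alpha>, i a) \<in> \<Omega>\<close> \<Omega>_p_right[OF \<alpha>(1)]
      by (simp add: bounded_linear_m' linear_0 bounded_linear.linear flip: zero_prod_def)
    ultimately have 4: "((\<lambda>a'. m (m (\<alpha>, m (\<psi> (f (\<xi> (m (i a, a')))), i (m (i a, a')))), i a)) has_derivative
        (\<lambda>v. 0)) (at a)" by simp
    \<comment> \<open>All intermediate products of that formula stay in the chart domain here, so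
      the composed chart maps really compute it.\<close>
    define W where "W = {k \<in> carrier G. k \<in> U \<and> f k \<in> U \<and> inv k \<in> U \<and> f k \<otimes> inv k \<in> U \<and> f x \<otimes> (f k \<otimes> inv k) \<in> U}"
    have "openin T ({k \<in> topspace T. k \<in> U} \<inter> {k \<in> topspace T. f k \<in> U} \<inter> {k \<in> topspace T. inv k \<in> U} \<inter>
        {k \<in> topspace T. f k \<otimes> inv k \<in> U} \<inter> {k \<in> topspace T. f x \<otimes> (f k \<otimes> inv k) \<in> U})"
      using xc by (intro openin_Int openin_continuous_map_preimage[OF _ openin_U] group_continuous_intros cont_f') auto
    then have W: "openin T W"
      by (rule back_subst) (auto simp: topspace_carrier W_def)
    show ?thesis
      using 4
    proof (rule has_derivative_transform_within_open)
      show "open {a' \<in> V. inv x \<otimes> \<xi> a' \<in> W}"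
        using xc by (intro open_chart_preimage[OF _ W] group_continuous_intros) auto
      show "a \<in> {a' \<in> V. inv x \<otimes> \<xi> a' \<in> W}"
        using aV xc xU one_in by (simp add: W_def flip: x_def)
      fix a' assume a': "a' \<in> {a' \<in> V. inv x \<otimes> \<xi> a' \<in> W}"
      define k where "k = inv x \<otimes> \<xi> a'"
      have k: "k \<in> carrier G" "k \<in> U" "f k \<in> U" "inv k \<in> U" "f k \<otimes> inv k \<in> U" "f x \<otimes> (f k \<otimes> inv k) \<in> U"
        using a' by (auto simp: W_def k_def)
      have mk: "m (i a, a') = \<psi> k" using \<xi>ia by (simp add: m_def k_def)
      have "m (\<psi> (f (\<xi> (\<psi> k))), i (\<psi> k)) = \<psi> (f k \<otimes> inv k)"
        using k by (simp add: m_def i_def)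
      moreover have "m (m (\<alpha>, \<psi> (f k \<otimes> inv k)), i a) = \<psi> (f x \<otimes> (f k \<otimes> inv k) \<otimes> inv x)"
        using k \<alpha> \<xi>ia by (simp add: m_def)
      moreover have "f x \<otimes> (f k \<otimes> inv k) \<otimes> inv x = f (\<xi> a') \<otimes> inv \<xi> a'"
      proof -
        have ac: "\<xi> a' \<in> carrier G" using a' by simp
        have xk: "\<xi> a' = x \<otimes> k" using xc ac by (simp add: k_def m_assoc[symmetric])
        have "f (x \<otimes> k) = f x \<otimes> f k"
          using g xc k(1) unfolding f_def conjugate_def
          by (simp add: m_assoc) (simp add: m_assoc[symmetric])
        then show ?thesis
          unfolding xk using xc k(1) by (simp add: m_assoc inv_mult_group)
      qed
      ultimately show "m (m (\<alpha>, m (\<psi> (f (\<xi> (m (i a, a')))), i (m (i a, a')))), i a) = \<Delta> a'"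
        by (simp add: mk \<Delta>_def)
    qed
  qed
  have fixed: "f (\<xi> a) = \<xi> a" if a: "a \<in> ball p r" for a
  proof -
    \<comment> \<open>The value at the centre of the ball is the image of the identity, so f fixes
      all elements near the identity.\<close>
    have "\<exists>c. \<forall>a\<in>ball p r. \<Delta> a = c"
    proof (rule has_derivative_zero_constant)
      show "(\<Delta> has_derivative (\<lambda>h. 0)) (at a within ball p r)" if "a \<in> ball p r" for a
        using \<Delta>_deriv that r(2) by (meson has_derivative_at_withinI subsetD)
    qed simp
    then have "\<Delta> a = \<Delta> p" using a r(1) by (metis centre_in_ball)
    moreover have "f (\<xi> a) \<otimes> inv \<xi> a \<in> U" "a \<in> V" using a r(2) by (auto simp: N_def)
    ultimately have "f (\<xi> a) \<otimes> inv \<xi> a = \<one>"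
      using inj one_in by (simp add: \<Delta>_def inj_on_def)
    then show ?thesis using \<open>a \<in> V\<close> by (metis \<xi>_carrier f_carrier inv_closed inv_equality inv_inv)
  qed
  have "{x \<in> carrier G. g \<otimes> x = x \<otimes> g} = carrier G"
  proof (rule eq_carrier_if_mult_closed_nhd[OF connected chart_nhd[OF open_ball, of p r]])
    show "p \<in> ball p r" "p \<in> ball p r" using r by auto
    show "{x \<in> U. \<psi> x \<in> ball p r} \<subseteq> {x \<in> carrier G. g \<otimes> x = x \<otimes> g}"
    proof
      fix x assume "x \<in> {x \<in> U. \<psi> x \<in> ball p r}"
      then have x: "x \<in> carrier G" "f x = x" using fixed[of "\<psi> x"] U_carrier by auto
      have "g \<otimes> x = f x \<otimes> g" using x(1) g by (simp add: f_def conjugate_def m_assoc)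
      then show "x \<in> {x \<in> carrier G. g \<otimes> x = x \<otimes> g}" using x by simp
    qed
    fix x y assume "x \<in> {x \<in> carrier G. g \<otimes> x = x \<otimes> g}" "y \<in> {x \<in> carrier G. g \<otimes> x = x \<otimes> g}"
    then show "x \<otimes> y \<in> {x \<in> carrier G. g \<otimes> x = x \<otimes> g}"
      using g by simp (metis m_assoc)
  qed auto
  then show ?thesis using x by blast
qed

end

section \<open>Fine factorizations in the adjoint group\<close>

context connected_lie_group_chart
begin

text \<open>The \<open>fine\<close> hypothesis of \<open>commute_in_compact_group\<close> for
  \<open>Ad g\<close>, as a property of g that can be spread from a neighbourhood of the identity by
  concatenation.\<close>

definition finely_factorizable where
  "finely_factorizable g \<longleftrightarrow> (\<forall>\<epsilon>>0. \<exists>N f. (\<forall>i. f i \<in> Ad ` carrier G) \<and> comp_upto f N = Ad g \<and>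
     (\<Sum>i<N. (norm (f i - id_blinfun))\<^sup>2) < \<epsilon>)"

lemma finely_factorizable_mult:
  assumes "g \<in> carrier G" "h \<in> carrier G" "finely_factorizable g" "finely_factorizable h"
  shows "finely_factorizable (g \<otimes> h)"
  unfolding finely_factorizable_def
proof (intro allI impI)
  fix \<epsilon> :: real assume "\<epsilon> > 0"
  then have "\<epsilon> / 2 > 0" by simp
  then obtain N u M v where u: "\<And>i. u i \<in> Ad ` carrier G" "comp_upto u N = Ad g"
      "(\<Sum>i<N. (norm (u i - id_blinfun))\<^sup>2) < \<epsilon> / 2"
    and v: "\<And>i. v i \<in> Ad ` carrier G" "comp_upto v M = Ad h" "(\<Sum>i<M. (norm (v i - id_blinfun))\<^sup>2) < \<epsilon> / 2"
    using assms unfolding finely_factorizable_def by meson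
  define w where "w i = (if i < N then u i else v (i - N))" for i
  have "(\<Sum>i<N + M. (norm (w i - id_blinfun))\<^sup>2) =
      (\<Sum>i<N. (norm (w i - id_blinfun))\<^sup>2) + (\<Sum>i<M. (norm (w (N + i) - id_blinfun))\<^sup>2)"
    by (induction M) auto
  also have "\<dots> < \<epsilon>"
    using u(3) v(3) by (simp add: w_def)
  finally have "(\<Sum>i<N + M. (norm (w i - id_blinfun))\<^sup>2) < \<epsilon>" .
  moreover have "comp_upto w N = comp_upto u N" "comp_upto (\<lambda>i. w (N + i)) M = comp_upto v M"
    by (auto intro!: comp_upto_cong simp: w_def)
  then have "comp_upto w (N + M) = Ad (g \<otimes> h)"
    by (simp add: comp_upto_add u v assms Ad_mult)
  ultimately show "\<exists>N f. (\<forall>i. f i \<in> Ad ` carrier G) \<and> comp_upto f N = Ad (g \<otimes> h) \<and>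
      (\<Sum>i<N. (norm (f i - id_blinfun))\<^sup>2) < \<epsilon>"
    using u(1) v(1) by (intro exI[of _ "N + M"] exI[of _ w]) (simp add: w_def)
qed

lemma compact_Ad: "compact_space T \<Longrightarrow> compact (Ad ` carrier G)"
  using image_compactin[OF _ continuous_map_Ad, of "carrier G"]
  by (simp add: compact_space_def topspace_carrier compactin_euclidean_iff)

text \<open>Near the identity, the segment from \<open>p\<close> to b in the chart is cut into N
  equal steps; by \<open>lip_at_Ad\<close> each quotient is within M L r / N of 1, where
  \<open>M\<close> bounds \<open>Ad\<close> by compactness, and the N squares add up to at most (M L
  r)^2 / N.\<close>

lemma finely_factorizable:
  assumes compact: "compact_space T" and g: "g \<in> carrier G"
  shows "finely_factorizable g"
proof -
  obtain M where M: "\<And>x. x \<in> carrier G \<Longrightarrow> norm (Ad x) \<le> M"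
    using compact_imp_bounded[OF compact_Ad[OF compact]] unfolding bounded_iff by blast
  have "0 \<le> M" using M[OF one_closed] norm_ge_zero order_trans by blast
  obtain r0 L where r0: "r0 > 0" "0 \<le> L"
      "\<And>x y. dist p x < r0 \<Longrightarrow> dist p y < r0 \<Longrightarrow> dist (Ad (\<xi> x)) (Ad (\<xi> y)) \<le> L * dist x y"
    using lip_atE[OF lip_at_Ad] by metis
  obtain r1 where r1: "r1 > 0" "ball p r1 \<subseteq> V" using open_V p_in open_contains_ball by blast
  define r where "r = min r0 r1"
  have r: "r > 0" using r0 r1 by (simp add: r_def)
  have near: "finely_factorizable (\<xi> b)" if b: "b \<in> ball p r" for b
    unfolding finely_factorizable_def
  proof (intro allI impI)
    fix \<epsilon> :: real assume \<epsilon>: "\<epsilon> > 0"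
    define E where "E = (M * (L * r))\<^sup>2"
    obtain n :: nat where n: "E / \<epsilon> < real n" using reals_Archimedean2 by blast
    define N where "N = Suc n"
    have N: "E / \<epsilon> < real N" "0 < real N" using n by (auto simp: N_def)
    define a where "a k = p + (real k / real N) *\<^sub>R (b - p)" for k
    have ab: "a k \<in> ball p r" if "k \<le> N" for k
    proof -
      have "dist p (a k) = (real k / real N) * dist p b"
        by (simp add: a_def dist_norm norm_minus_commute)
      also have "\<dots> \<le> 1 * dist p b"
        using that N by (intro mult_right_mono) auto
      finally show ?thesis using b by simp
    qed
    have aV: "a k \<in> V" if "k \<le> N" for k using ab[OF that] r1 by (auto simp: r_def)
    have diff: "dist (a k) (a (Suc k)) \<le> r / real N" for k
    proof -
      have "a (Suc k) - a k = (1 / real N) *\<^sub>R (b - p)"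
        by (simp add: a_def add_divide_distrib algebra_simps)
      then have "dist (a k) (a (Suc k)) = dist p b / real N"
        by (simp add: dist_norm norm_minus_commute[of "a k"] norm_minus_commute[of p b])
      also have "\<dots> \<le> r / real N" using b N by (intro divide_right_mono) auto
      finally show ?thesis .
    qed
    \<comment> \<open>Quotients of consecutive points, so that the product telescopes. Past N the
      points may leave the chart, while every value must lie in the image of \<open>Ad\<close>;
      hence the identity there.\<close>
    define f where "f k = (if k < N then Ad (inv \<xi> (a k) \<otimes> \<xi> (a (Suc k))) else id_blinfun)" for k
    have fK: "f k \<in> Ad ` carrier G" for k
      using aV[of k] aV[of "Suc k"] by (auto simp: f_def Ad_one[symmetric])
    have "comp_upto f k = Ad (\<xi> (a k))" if "k \<le> N" for k
      using that
    proof (induction k)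
      case 0
      then show ?case by (simp add: a_def Ad_one)
    next
      case (Suc k)
      then have k: "k < N" "\<xi> (a k) \<in> carrier G" "\<xi> (a (Suc k)) \<in> carrier G"
        using aV[of k] aV[of "Suc k"] by auto
      have "f k = Ad (inv \<xi> (a k) \<otimes> \<xi> (a (Suc k)))" using k by (simp add: f_def)
      then have "comp_upto f (Suc k) = Ad (\<xi> (a k) \<otimes> (inv \<xi> (a k) \<otimes> \<xi> (a (Suc k))))"
        using Suc k by (simp add: Ad_mult)
      then show ?case using k by (simp add: m_assoc[symmetric])
    qed
    from this[of N] have comp: "comp_upto f N = Ad (\<xi> b)" using N by (simp add: a_def)
    have "norm (f k - id_blinfun) \<le> M * (L * r) / real N" if "k < N" for k
    proof -
      have k: "\<xi> (a k) \<in> carrier G" "\<xi> (a (Suc k)) \<in> carrier G"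
        using aV[of k] aV[of "Suc k"] that by auto
      have "f k - id_blinfun = Ad (inv \<xi> (a k)) o\<^sub>L (Ad (\<xi> (a (Suc k))) - Ad (\<xi> (a k)))"
        using that k by (simp add: f_def Ad_mult blinfun.bilinear_simps blinfun_eqI flip: Ad_inv(1)[OF k(1)])
      then have "norm (f k - id_blinfun) \<le> norm (Ad (inv \<xi> (a k))) * dist (Ad (\<xi> (a (Suc k)))) (Ad (\<xi> (a k)))"
        unfolding dist_norm by (metis norm_blinfun_compose)
      also have "\<dots> \<le> M * (L * dist (a (Suc k)) (a k))"
        using ab[of k] ab[of "Suc k"] that k \<open>0 \<le> M\<close>
        by (intro mult_mono M r0(3)) (auto simp: r_def)
      also have "\<dots> \<le> M * (L * (r / real N))"
        using diff[of k] \<open>0 \<le> M\<close> r0(2) by (intro mult_left_mono) (auto simp: dist_commute)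
      finally show ?thesis by simp
    qed
    then have "(\<Sum>k<N. (norm (f k - id_blinfun))\<^sup>2) \<le> (\<Sum>k<N. (M * (L * r) / real N)\<^sup>2)"
      by (intro sum_mono power_mono) auto
    also have "\<dots> = E / real N"
      using N by (simp add: E_def power2_eq_square)
    also have "\<dots> < \<epsilon>" using N \<epsilon> by (simp add: field_simps)
    finally show "\<exists>N f. (\<forall>i. f i \<in> Ad ` carrier G) \<and> comp_upto f N = Ad (\<xi> b) \<and>
        (\<Sum>i<N. (norm (f i - id_blinfun))\<^sup>2) < \<epsilon>"
      using fK comp by blast
  qed
  have "{g \<in> carrier G. finely_factorizable g} = carrier G"
  proof (rule eq_carrier_if_mult_closed_nhd[OF connected chart_nhd[OF open_ball, of p r]])
    show "p \<in> ball p r" "p \<in> ball p r" using r by auto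
    show "{x \<in> U. \<psi> x \<in> ball p r} \<subseteq> {g \<in> carrier G. finely_factorizable g}"
      using near U_carrier by (metis (mono_tags, lifting) \<xi>_\<psi> mem_Collect_eq subsetI)
    fix x y assume "x \<in> {g \<in> carrier G. finely_factorizable g}" "y \<in> {g \<in> carrier G. finely_factorizable g}"
    then show "x \<otimes> y \<in> {g \<in> carrier G. finely_factorizable g}"
      using finely_factorizable_mult by blast
  qed auto
  then show ?thesis using g by blast
qed

lemma Ad_commute_if_single_class:
  assumes compact: "compact_space T" and cd: "c \<in> carrier G" "d \<in> carrier G"
    and single: "\<And>g. g \<in> carrier G \<Longrightarrow> \<exists>h\<in>carrier G. conj_by g c \<otimes> d = conj_by h (c \<otimes> d)"
  shows "Ad c o\<^sub>L Ad d = Ad d o\<^sub>L Ad c"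
proof -
  \<comment> \<open>\<open>Ad\<close> need not be injective, so inversion on its image goes through
    a chosen preimage; the next step shows independence of the choice.\<close>
  define J where "J A = Ad (inv (SOME g. g \<in> carrier G \<and> Ad g = A))" for A
  have J: "J (Ad g) = Ad (inv g)" if g: "g \<in> carrier G" for g
  proof -
    define h where "h = (SOME h. h \<in> carrier G \<and> Ad h = Ad g)"
    have h: "h \<in> carrier G" "Ad h = Ad g"
      using someI[of "\<lambda>h. h \<in> carrier G \<and> Ad h = Ad g" g] g by (auto simp: h_def)
    have "J (Ad g) = Ad (inv h) o\<^sub>L (Ad g o\<^sub>L Ad (inv g))"
      using Ad_inv(2)[OF g] by (simp add: J_def h_def)
    also have "\<dots> = (Ad (inv h) o\<^sub>L Ad h) o\<^sub>L Ad (inv g)"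
      by (simp add: h blinfun_compose_assoc)
    finally show ?thesis using Ad_inv(1)[OF h(1)] by simp
  qed
  show ?thesis
  proof (rule commute_in_compact_group[of "Ad ` carrier G" J, OF compact_Ad[OF compact]])
    show "id_blinfun \<in> Ad ` carrier G" using Ad_one by (metis image_eqI one_closed)
    show "A o\<^sub>L B \<in> Ad ` carrier G" if "A \<in> Ad ` carrier G" "B \<in> Ad ` carrier G" for A B
      using that by (auto simp flip: Ad_mult)
    show "J A \<in> Ad ` carrier G" "J A o\<^sub>L A = id_blinfun" "A o\<^sub>L J A = id_blinfun"
      if "A \<in> Ad ` carrier G" for A
      using that J Ad_inv by auto
    show "Ad c \<in> Ad ` carrier G" "Ad d \<in> Ad ` carrier G" using cd by auto
    fix Q assume "Q \<in> Ad ` carrier G"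
    then obtain g where g: "g \<in> carrier G" "Q = Ad g" by blast
    obtain h where h: "h \<in> carrier G" "conj_by g c \<otimes> d = conj_by h (c \<otimes> d)" using single[OF g(1)] by blast
    have "(Q o\<^sub>L (Ad c o\<^sub>L J Q)) o\<^sub>L Ad d = Ad (conj_by g c \<otimes> d)"
      using g cd by (simp add: conjugate_def Ad_mult J blinfun_compose_assoc)
    also have "\<dots> = Ad h o\<^sub>L ((Ad c o\<^sub>L Ad d) o\<^sub>L J (Ad h))"
      unfolding h(2) using h(1) cd by (simp add: conjugate_def Ad_mult J blinfun_compose_assoc)
    finally show "\<exists>B\<in>Ad ` carrier G. (Q o\<^sub>L (Ad c o\<^sub>L J Q)) o\<^sub>L Ad d = B o\<^sub>L ((Ad c o\<^sub>L Ad d) o\<^sub>L J B)"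
      using h(1) by blast
  next
    fix \<epsilon> :: real assume "\<epsilon> > 0"
    then show "\<exists>N f. (\<forall>i. f i \<in> Ad ` carrier G) \<and> comp_upto f N = Ad c o\<^sub>L Ad d \<and>
        (\<Sum>i<N. (norm (f i - id_blinfun))\<^sup>2) < \<epsilon>"
      using finely_factorizable[OF compact, of "c \<otimes> d"] cd
      by (simp add: finely_factorizable_def Ad_mult)
  qed
qed

end

section \<open>Products of conjugacy classes\<close>

context lie_group
begin

lemma compactin_image:
  "compact_space X \<Longrightarrow> continuous_map X T f \<Longrightarrow> compactin T (f ` topspace X)"
  by (metis compact_space_def image_compactin)

lemma connectedin_image:
  "connected_space X \<Longrightarrow> continuous_map X T f \<Longrightarrow> connectedin T (f ` topspace X)"
  by (metis connectedin_continuous_map_image connectedin_topspace)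

lemma subgroup_closure:
  assumes "subgroup S G" shows "subgroup (T closure_of S) G"
proof
  have S: "S \<subseteq> carrier G" using subgroup.subset[OF assms] .
  have le: "S \<subseteq> T closure_of S" using S by (simp add: closure_of_subset topspace_carrier)
  show "T closure_of S \<subseteq> carrier G" using closure_of_subset_topspace topspace_carrier by metis
  show "\<one> \<in> T closure_of S" using le subgroup.one_closed[OF assms] by blast
  show "inv x \<in> T closure_of S" if "x \<in> T closure_of S" for x
  proof -
    have "(\<lambda>x. inv x) ` (T closure_of S) \<subseteq> T closure_of ((\<lambda>x. inv x) ` S)"
      by (intro continuous_map_image_closure_subset continuous_map_inv continuous_map_ident)
    also have "\<dots> \<subseteq> T closure_of S"
      using subgroup.m_inv_closed[OF assms] by (intro closure_of_mono) auto
    finally show ?thesis using that by blast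
  qed
  show "x \<otimes> y \<in> T closure_of S" if "x \<in> T closure_of S" "y \<in> T closure_of S" for x y
  proof -
    have "(\<lambda>(x, y). x \<otimes> y) ` (prod_topology T T closure_of (S \<times> S)) \<subseteq> T closure_of ((\<lambda>(x, y). x \<otimes> y) ` (S \<times> S))"
      using smooth_mult by (intro continuous_map_image_closure_subset) (simp add: smooth_map_def)
    also have "\<dots> \<subseteq> T closure_of S"
      using subgroup.m_closed[OF assms] by (intro closure_of_mono) auto
    finally show ?thesis using that by (auto simp: closure_of_Times)
  qed
qed

lemma normal_closure:
  assumes "S \<lhd> G" shows "T closure_of S \<lhd> G"
proof (rule normal_invI)
  interpret S: normal S G by fact
  show "subgroup (T closure_of S) G" by (intro subgroup_closure S.subgroup_axioms)
  fix g h assume g: "g \<in> carrier G" and h: "h \<in> T closure_of S"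
  have "conj_by g ` (T closure_of S) \<subseteq> T closure_of (conj_by g ` S)"
    by (intro continuous_map_image_closure_subset continuous_map_conj_by g)
  also have "\<dots> \<subseteq> T closure_of S"
    using S.inv_op_closed2[OF g] by (intro closure_of_mono) (auto simp: conjugate_def)
  finally show "g \<otimes> h \<otimes> inv g \<in> T closure_of S" using h by (auto simp: conjugate_def)
qed

text \<open>Every word lies together with the identity in a connected subset of the generated group:
  for h1 h2, the set for h1 and the translate by h1 of the set for h2 share the point h1.\<close>

lemma connectedin_generate:
  assumes X: "connectedin T X" "\<one> \<in> X" shows "connectedin T (generate G X)"
proof -
  have Xc: "X \<subseteq> carrier G" using X(1) connectedin_subset_topspace topspace_carrier by metis
  have *: "\<exists>S. connectedin T S \<and> \<one> \<in> S \<and> h \<in> S \<and> S \<subseteq> generate G X" if "h \<in> generate G X" for h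
    using that
  proof (induction h rule: generate.induct)
    case one
    then show ?case by (intro exI[of _ "{\<one>}"]) (auto simp: topspace_carrier generate.one)
  next
    case (incl h)
    then show ?case using X by (intro exI[of _ X]) (auto intro: generate.incl)
  next
    case (inv h)
    have "connectedin T ((\<lambda>x. inv x) ` X)"
      by (intro connectedin_continuous_map_image[OF _ X(1)] continuous_map_inv continuous_map_ident)
    moreover have "\<one> \<in> (\<lambda>x. inv x) ` X" using X(2) by (metis image_eqI inv_one)
    ultimately show ?case using inv by (intro exI[of _ "(\<lambda>x. inv x) ` X"]) (auto intro: generate.inv)
  next
    case (eng h1 h2)
    then obtain S1 S2 where S1: "connectedin T S1" "\<one> \<in> S1" "h1 \<in> S1" "S1 \<subseteq> generate G X"
      and S2: "connectedin T S2" "\<one> \<in> S2" "h2 \<in> S2" "S2 \<subseteq> generate G X" by blast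
    have h1: "h1 \<in> carrier G" using eng.hyps(1) generate_in_carrier[OF Xc] by blast
    have "connectedin T ((\<lambda>x. h1 \<otimes> x) ` S2)"
      by (intro connectedin_continuous_map_image[OF _ S2(1)] group_continuous_intros h1)
    moreover have "h1 \<in> (\<lambda>x. h1 \<otimes> x) ` S2" using S2(2) h1 by (metis image_eqI r_one)
    ultimately have "connectedin T (S1 \<union> (\<lambda>x. h1 \<otimes> x) ` S2)"
      using S1 by (intro connectedin_Un) auto
    then show ?case using S1 S2 eng.hyps(1)
      by (intro exI[of _ "S1 \<union> (\<lambda>x. h1 \<otimes> x) ` S2"]) (auto intro: generate.eng)
  qed
  define \<S> where "\<S> = {S. connectedin T S \<and> \<one> \<in> S \<and> S \<subseteq> generate G X}"
  have "connectedin T (\<Union>\<S>)" by (rule connectedin_Union) (auto simp: \<S>_def)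
  moreover have "\<Union>\<S> = generate G X" using * by (fastforce simp: \<S>_def)
  ultimately show ?thesis by simp
qed

lemma conjugacy_class_image: "conjugacy_class G x = (\<lambda>g. g \<otimes> x \<otimes> inv g) ` carrier G"
  by (auto simp: conjugacy_class_def)

lemma continuous_map_orbit: "x \<in> carrier G \<Longrightarrow> continuous_map T T (\<lambda>g. g \<otimes> x \<otimes> inv g)"
  by (intro group_continuous_intros)

lemma conjugacy_class_subset: "x \<in> carrier G \<Longrightarrow> conjugacy_class G x \<subseteq> carrier G"
  by (auto simp: conjugacy_class_def)

lemma conjugacy_class_self: "x \<in> carrier G \<Longrightarrow> x \<in> conjugacy_class G x"
  by (auto simp: conjugacy_class_def intro!: exI[of _ \<one>])

lemma conjugacy_class_eq:
  assumes "x \<in> carrier G" "y \<in> conjugacy_class G x" shows "conjugacy_class G y = conjugacy_class G x"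
proof -
  obtain g where g: "g \<in> carrier G" "y = conj_by g x"
    using assms(2) by (auto simp: conjugacy_class_def conjugate_def)
  have "conj_by h y = conj_by (h \<otimes> g) x" if "h \<in> carrier G" for h
    using that g assms(1) by (simp add: conj_by_mult)
  moreover have "conj_by h x = conj_by (h \<otimes> inv g) y" if "h \<in> carrier G" for h
    using that g assms(1) by (simp add: conj_by_mult[symmetric] m_assoc)
  ultimately show ?thesis
    using g(1) unfolding conjugacy_class_def conjugate_def[symmetric]
    by (intro subset_antisym subsetI; clarsimp) (metis m_closed inv_closed)+
qed

lemma conj_by_in_class: "g \<in> carrier G \<Longrightarrow> x \<in> carrier G \<Longrightarrow> y \<in> conjugacy_class G x \<Longrightarrow> conj_by g y \<in> conjugacy_class G x"
  using conjugacy_class_eq[of x y] by (auto simp: conjugacy_class_def conjugate_def)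

lemma conjugacy_class_central:
  "x \<in> group_center G \<Longrightarrow> conjugacy_class G x \<subseteq> group_center G"
proof
  fix y assume x: "x \<in> group_center G" and "y \<in> conjugacy_class G x"
  then obtain g where g: "g \<in> carrier G" "y = g \<otimes> x \<otimes> inv g" by (auto simp: conjugacy_class_def)
  then have "y = x" using x by (simp add: group_center_def m_assoc)
  then show "y \<in> group_center G" using x by simp
qed

end

section \<open>Centrality from commuting adjoint images\<close>

context simple_lie_group
begin

lemma central_if_Ad_commutes:
  assumes chart: "connected_lie_group_chart G T A U \<psi>" and compact: "compact_space T"
    and c: "c \<in> carrier G" and d: "d \<in> carrier G" "d \<notin> group_center G"
    and comm: "\<And>c' d'. c' \<in> conjugacy_class G c \<Longrightarrow> d' \<in> conjugacy_class G d \<Longrightarrow>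
      connected_lie_group_chart.Ad G U \<psi> c' o\<^sub>L connected_lie_group_chart.Ad G U \<psi> d' =
      connected_lie_group_chart.Ad G U \<psi> d' o\<^sub>L connected_lie_group_chart.Ad G U \<psi> c'"
  shows "c \<in> group_center G"
proof -
  interpret connected_lie_group_chart G T A U \<psi> by fact
  \<comment> \<open>By \<open>comm\<close> this set contains the class of d. It is a closed
    subgroup, so it contains the closure \<open>H\<close> of the group generated by quotients of
    elements of that class.\<close>
  define M where "M = {x \<in> carrier G. \<forall>c'\<in>conjugacy_class G c. Ad c' o\<^sub>L Ad x = Ad x o\<^sub>L Ad c'}"
  have sub: "subgroup M G"
  proof
    show "M \<subseteq> carrier G" "\<one> \<in> M" by (auto simp: M_def Ad_one)
    show "x \<otimes> y \<in> M" if "x \<in> M" "y \<in> M" for x y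
    proof -
      have xy: "x \<in> carrier G" "y \<in> carrier G" using that by (auto simp: M_def)
      have "Ad c' o\<^sub>L Ad (x \<otimes> y) = Ad (x \<otimes> y) o\<^sub>L Ad c'" if "c' \<in> conjugacy_class G c" for c'
      proof -
        have "Ad c' o\<^sub>L Ad (x \<otimes> y) = (Ad c' o\<^sub>L Ad x) o\<^sub>L Ad y"
          using xy by (simp add: Ad_mult blinfun_compose_assoc)
        also have "\<dots> = (Ad x o\<^sub>L Ad c') o\<^sub>L Ad y" using \<open>x \<in> M\<close> that by (simp add: M_def)
        also have "\<dots> = Ad x o\<^sub>L (Ad c' o\<^sub>L Ad y)" by (rule blinfun_compose_assoc)
        also have "\<dots> = Ad x o\<^sub>L (Ad y o\<^sub>L Ad c')" using \<open>y \<in> M\<close> that by (simp add: M_def)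
        finally show ?thesis using xy by (simp add: Ad_mult blinfun_compose_assoc)
      qed
      then show ?thesis using xy by (simp add: M_def)
    qed
    show "inv x \<in> M" if "x \<in> M" for x
    proof -
      have x: "x \<in> carrier G" using that by (simp add: M_def)
      have "Ad c' o\<^sub>L Ad (inv x) = Ad (inv x) o\<^sub>L Ad c'" if "c' \<in> conjugacy_class G c" for c'
      proof -
        have "Ad (inv x) o\<^sub>L ((Ad c' o\<^sub>L Ad x) o\<^sub>L Ad (inv x)) = Ad (inv x) o\<^sub>L ((Ad x o\<^sub>L Ad c') o\<^sub>L Ad (inv x))"
          using \<open>x \<in> M\<close> that by (simp add: M_def)
        moreover have "Ad (inv x) o\<^sub>L ((Ad c' o\<^sub>L Ad x) o\<^sub>L Ad (inv x)) = Ad (inv x) o\<^sub>L Ad c'"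
          by (simp add: blinfun_compose_assoc Ad_inv(2)[OF x])
        moreover have "Ad (inv x) o\<^sub>L ((Ad x o\<^sub>L Ad c') o\<^sub>L Ad (inv x)) = (Ad (inv x) o\<^sub>L Ad x) o\<^sub>L (Ad c' o\<^sub>L Ad (inv x))"
          by (simp add: blinfun_compose_assoc)
        ultimately show ?thesis by (simp add: Ad_inv(1)[OF x])
      qed
      then show ?thesis using x by (simp add: M_def)
    qed
  qed
  have closed: "closedin T M"
  proof -
    have "closedin T {x \<in> topspace T. (Ad c' o\<^sub>L Ad x) - (Ad x o\<^sub>L Ad c') \<in> {0}}" for c'
    proof (rule closedin_continuous_map_preimage)
      have "continuous_map euclidean euclidean (\<lambda>X. (Ad c' o\<^sub>L X) - (X o\<^sub>L Ad c'))"
        by (simp add: continuous_map_iff_continuous2) (intro continuous_intros)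
      from continuous_map_compose[OF continuous_map_Ad this]
      show "continuous_map T euclidean (\<lambda>x. (Ad c' o\<^sub>L Ad x) - (Ad x o\<^sub>L Ad c'))" by (simp add: o_def)
    qed simp
    then have "closedin T (\<Inter>c'\<in>conjugacy_class G c. {x \<in> topspace T. (Ad c' o\<^sub>L Ad x) - (Ad x o\<^sub>L Ad c') \<in> {0}})"
      using conjugacy_class_self[OF c] by (intro closedin_Inter) auto
    moreover have "(\<Inter>c'\<in>conjugacy_class G c. {x \<in> topspace T. (Ad c' o\<^sub>L Ad x) - (Ad x o\<^sub>L Ad c') \<in> {0}}) = M"
      using conjugacy_class_self[OF c] by (auto simp: M_def topspace_carrier)
    ultimately show ?thesis by simp
  qed
  \<comment> \<open>The quotients are a continuous image of G x G, so they form a connected set, and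
    it contains the identity, which the class of the noncentral d does not.\<close>
  define X where "X = (\<lambda>(g, h). (g \<otimes> d \<otimes> inv g) \<otimes> inv (h \<otimes> d \<otimes> inv h)) ` (carrier G \<times> carrier G)"
  have XI: "x \<otimes> inv y \<in> X" if "x \<in> conjugacy_class G d" "y \<in> conjugacy_class G d" for x y
    using that by (fastforce simp: X_def conjugacy_class_def)
  have XE: "\<exists>x\<in>conjugacy_class G d. \<exists>y\<in>conjugacy_class G d. z = x \<otimes> inv y" if "z \<in> X" for z
    using that by (fastforce simp: X_def conjugacy_class_def)
  have class_d: "x \<in> carrier G" if "x \<in> conjugacy_class G d" for x
    using that conjugacy_class_subset[OF d(1)] by blast
  have X_carrier: "X \<subseteq> carrier G" using XE class_d by fastforce
  have one_X: "\<one> \<in> X" using XI[OF conjugacy_class_self[OF d(1)] conjugacy_class_self[OF d(1)]] d by simp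
  have conn_X: "connectedin T X"
  proof -
    have "connected_space (prod_topology T T)" using connected by (simp add: connected_space_prod_topology)
    moreover have "continuous_map (prod_topology T T) T (\<lambda>z. (fst z \<otimes> d \<otimes> inv (fst z)) \<otimes> inv (snd z \<otimes> d \<otimes> inv (snd z)))"
      using d(1) by (intro group_continuous_intros continuous_map_fst continuous_map_snd)
    ultimately have "connectedin T ((\<lambda>z. (fst z \<otimes> d \<otimes> inv (fst z)) \<otimes> inv (snd z \<otimes> d \<otimes> inv (snd z))) ` topspace (prod_topology T T))"
      by (rule connectedin_image)
    then show ?thesis by (simp add: X_def topspace_carrier case_prod_unfold)
  qed
  define H where "H = T closure_of (generate G X)"
  have "generate G X \<lhd> G"
  proof (rule normal_generateI[OF X_carrier])
    fix h g assume h: "h \<in> X" and g: "g \<in> carrier G"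
    obtain x y where xy: "x \<in> conjugacy_class G d" "y \<in> conjugacy_class G d" "h = x \<otimes> inv y" using XE[OF h] by blast
    have "g \<otimes> h \<otimes> inv g = conj_by g x \<otimes> inv (conj_by g y)"
      using g class_d[OF xy(1)] class_d[OF xy(2)]
      by (simp add: xy(3) conjugate_def inv_mult_group m_assoc) (simp add: m_assoc[symmetric])
    then show "g \<otimes> h \<otimes> inv g \<in> X" using XI conj_by_in_class[OF g d(1)] xy by simp
  qed
  then have "H \<lhd> G" unfolding H_def by (rule normal_closure)
  moreover have "closedin T H" by (simp add: H_def)
  moreover have "connectedin T H"
    unfolding H_def by (intro connectedin_closure_of connectedin_generate conn_X one_X)
  moreover have gen_H: "generate G X \<subseteq> H"
    unfolding H_def using generate_in_carrier[OF X_carrier] by (intro closure_of_subset) (auto simp: topspace_carrier)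
  moreover have "H \<noteq> {\<one>}"
  proof
    \<comment> \<open>All quotients (g d g^-1) d^-1 would then be trivial, making d central.\<close>
    assume "H = {\<one>}"
    have "g \<otimes> d = d \<otimes> g" if g: "g \<in> carrier G" for g
    proof -
      have gd: "conj_by g d \<in> conjugacy_class G d" using g d conj_by_in_class conjugacy_class_self by blast
      have "conj_by g d \<otimes> inv d \<in> generate G X"
        using XI[OF gd conjugacy_class_self[OF d(1)]] by (rule generate.incl)
      then have "conj_by g d \<otimes> inv d = \<one>" using gen_H \<open>H = {\<one>}\<close> by blast
      then have "conj_by g d = d" using g d(1) by (metis conj_by_carrier inv_closed inv_equality inv_inv)
      then have "conj_by g d \<otimes> g = d \<otimes> g" by simp
      then show ?thesis using g d(1) by (simp add: conjugate_def m_assoc)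
    qed
    then show False using d by (simp add: group_center_def)
  qed
  ultimately have "H = carrier G" using no_connected_normal by blast
  moreover have "X \<subseteq> M"
  proof
    fix z assume "z \<in> X"
    then obtain x y where xy: "x \<in> conjugacy_class G d" "y \<in> conjugacy_class G d" "z = x \<otimes> inv y" using XE by blast
    then have "x \<in> M" "y \<in> M" using comm class_d by (auto simp: M_def)
    then show "z \<in> M" using xy(3) subgroup.m_closed[OF sub] subgroup.m_inv_closed[OF sub] by simp
  qed
  then have "generate G X \<subseteq> M" by (rule generate_subgroup_incl[OF _ sub])
  then have "H \<subseteq> M" unfolding H_def using closed by (rule closure_of_minimal)
  ultimately have M: "M = carrier G" by (auto simp: M_def)
  \<comment> \<open>The commutator with c. As \<open>Ad c\<close> commutes with every
    \<open>Ad x\<close>, its values lie in the kernel of \<open>Ad\<close> and are therefore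
    central.\<close>
  define q where "q x = c \<otimes> x \<otimes> inv c \<otimes> inv x" for x
  have q_carrier: "q x \<in> carrier G" if "x \<in> carrier G" for x using that c by (simp add: q_def)
  have q_central: "q x \<otimes> y = y \<otimes> q x" if x: "x \<in> carrier G" and y: "y \<in> carrier G" for x y
  proof (rule central_if_Ad_trivial[OF q_carrier[OF x] _ y])
    have "Ad c o\<^sub>L Ad x = Ad x o\<^sub>L Ad c" using M x conjugacy_class_self[OF c] by (auto simp: M_def)
    then have "Ad (q x) = (Ad x o\<^sub>L Ad c) o\<^sub>L (Ad (inv c) o\<^sub>L Ad (inv x))"
      using x c by (simp add: q_def Ad_mult blinfun_compose_assoc)
    also have "\<dots> = Ad x o\<^sub>L ((Ad c o\<^sub>L Ad (inv c)) o\<^sub>L Ad (inv x))" by (simp add: blinfun_compose_assoc)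
    finally show "Ad (q x) = id_blinfun" using x c by (simp add: Ad_inv)
  qed
  have q_mult: "q (x \<otimes> y) = q x \<otimes> q y" if x: "x \<in> carrier G" and y: "y \<in> carrier G" for x y
  proof -
    \<comment> \<open>Only x^-1 separates q y from the rest of q x, and the central q y can be moved
      past it.\<close>
    have "q (x \<otimes> y) = c \<otimes> x \<otimes> inv c \<otimes> (q y \<otimes> inv x)"
      using c x y by (simp add: q_def inv_mult_group m_assoc) (simp add: m_assoc[symmetric])
    also have "q y \<otimes> inv x = inv x \<otimes> q y" using x y by (intro q_central) auto
    finally show ?thesis using c x q_carrier[OF y] by (simp add: q_def m_assoc)
  qed
  have q_one: "q \<one> = \<one>" using c by (simp add: q_def)
  define L where "L = q ` carrier G"
  have "subgroup L G"
  proof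
    show "L \<subseteq> carrier G" using q_carrier by (auto simp: L_def)
    show "x \<otimes> y \<in> L" if "x \<in> L" "y \<in> L" for x y using that by (auto simp: L_def simp flip: q_mult)
    show "\<one> \<in> L" unfolding L_def using q_one by (metis image_eqI one_closed)
    show "inv x \<in> L" if "x \<in> L" for x
    proof -
      obtain y where y: "y \<in> carrier G" "x = q y" using \<open>x \<in> L\<close> by (auto simp: L_def)
      have "q (inv y) \<otimes> q y = \<one>" using y q_one by (simp flip: q_mult)
      then have "inv x = q (inv y)" using y q_carrier inv_equality by simp
      then show ?thesis using y by (simp add: L_def)
    qed
  qed
  then have "L \<lhd> G"
  proof (rule normal_invI)
    fix g h assume g: "g \<in> carrier G" and "h \<in> L"
    then obtain y where y: "y \<in> carrier G" "h = q y" by (auto simp: L_def)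
    have "g \<otimes> h \<otimes> inv g = h"
      using q_central[OF y(1) g] g q_carrier[OF y(1)] y(2) by (metis m_assoc inv_closed r_inv r_one)
    then show "g \<otimes> h \<otimes> inv g \<in> L" using \<open>h \<in> L\<close> by simp
  qed
  \<comment> \<open>Connectedness makes the image \<open>L\<close> connected, and compactness makes
    it compact, hence closed in the Hausdorff topology; its elements being central, it is
    normal.\<close>
  moreover have cont_q: "continuous_map T T q"
    unfolding q_def using c by (intro group_continuous_intros) auto
  then have "connectedin T L" "closedin T L"
    using connectedin_image[OF connected cont_q] compactin_image[OF compact cont_q]
      compactin_imp_closedin[OF Hausdorff] by (auto simp: L_def topspace_carrier)
  ultimately have "L = {\<one>} \<or> L = carrier G" using no_connected_normal by blast
  then show ?thesis
  proof
    assume "L = {\<one>}"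
    have "x \<otimes> c = c \<otimes> x" if x: "x \<in> carrier G" for x
    proof -
      have "q x = \<one>" using x \<open>L = {\<one>}\<close> by (auto simp: L_def)
      then have "q x \<otimes> (x \<otimes> c) = x \<otimes> c" using x c by simp
      moreover have "q x \<otimes> (x \<otimes> c) = c \<otimes> x"
        using x c by (simp add: q_def m_assoc) (simp add: m_assoc[symmetric])
      ultimately show ?thesis by simp
    qed
    then show ?thesis using c by (simp add: group_center_def)
  next
    \<comment> \<open>Every element would be a value of q, hence central, and the group would be
      abelian.\<close>
    assume L: "L = carrier G"
    have "comm_group G"
    proof (rule group_comm_groupI)
      fix x y assume "x \<in> carrier G" and y: "y \<in> carrier G"
      then obtain x' where "x' \<in> carrier G" "x = q x'" using L by (auto simp: L_def)
      then show "x \<otimes> y = y \<otimes> x" using q_central y by simp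
    qed
    then show ?thesis using nonabelian by simp
  qed
qed

end

theorem theorem1p5:
  fixes G :: "('a, 'b) monoid_scheme"
    and T :: "'a topology"
    and A :: "('a, 'e::euclidean_space) chart set"
    and C D :: "'a set"
  assumes "simple_lie_group G T A"
    and "compact_space T"
    and "C \<in> conjugacy_classes G" and "\<not> C \<subseteq> group_center G"
    and "D \<in> conjugacy_classes G" and "\<not> D \<subseteq> group_center G"
  shows "\<exists>\<E>. \<E> \<subseteq> conjugacy_classes G \<and> infinite \<E> \<and> C <#>\<^bsub>G\<^esub> D = \<Union>\<E>"
proof -
  interpret simple_lie_group G T A by fact
  obtain U \<psi> where chart: "(U, \<psi>) \<in> A" "\<one>\<^bsub>G\<^esub> \<in> U"
    using cover topspace_carrier one_closed by blast
  interpret connected_lie_group_chart G T A U \<psi>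
    by unfold_locales (use chart connected in auto)
  obtain c where c: "c \<in> carrier G" "C = conjugacy_class G c"
    using assms(3) by (auto simp: conjugacy_classes_def)
  obtain d where d: "d \<in> carrier G" "D = conjugacy_class G d"
    using assms(5) by (auto simp: conjugacy_classes_def)
  have noncentral: "c \<notin> group_center G" "d \<notin> group_center G"
    using assms(4,6) c d conjugacy_class_central by auto
  have C_carrier: "x \<in> carrier G" if "x \<in> C" for x using that c conjugacy_class_subset by auto
  have D_carrier: "x \<in> carrier G" if "x \<in> D" for x using that d conjugacy_class_subset by auto
  define P where "P = C <#>\<^bsub>G\<^esub> D"
  have PI: "x \<otimes>\<^bsub>G\<^esub> y \<in> P" if "x \<in> C" "y \<in> D" for x y
    using that by (auto simp: P_def set_mult_def)
  have P_carrier: "P \<subseteq> carrier G" using C_carrier D_carrier by (auto simp: P_def set_mult_def)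
  have class_P: "conjugacy_class G z \<subseteq> P" if z: "z \<in> P" for z
  proof
    fix w assume "w \<in> conjugacy_class G z"
    then obtain g where g: "g \<in> carrier G" "w = conj_by g z" by (auto simp: conjugacy_class_def conjugate_def)
    obtain x y where xy: "x \<in> C" "y \<in> D" "z = x \<otimes>\<^bsub>G\<^esub> y" using z by (auto simp: P_def set_mult_def)
    have "w = conj_by g x \<otimes>\<^bsub>G\<^esub> conj_by g y"
      using g xy C_carrier D_carrier by (simp add: conjugate_def m_assoc) (simp add: m_assoc[symmetric])
    then show "w \<in> P" using PI conj_by_in_class g(1) c d xy by simp
  qed
  \<comment> \<open>The classes met by CD. Since CD is stable under conjugation, it contains each of
    them and is their union.\<close>
  define \<E> where "\<E> = conjugacy_class G ` P"
  have classes: "\<E> \<subseteq> conjugacy_classes G" using P_carrier by (auto simp: \<E>_def conjugacy_classes_def)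
  have Union: "P = \<Union>\<E>"
  proof (intro subset_antisym subsetI)
    fix z assume "z \<in> P"
    then have "z \<in> conjugacy_class G z" using conjugacy_class_self P_carrier by blast
    then show "z \<in> \<Union>\<E>" using \<open>z \<in> P\<close> unfolding \<E>_def by blast
  next
    fix z assume "z \<in> \<Union>\<E>"
    then show "z \<in> P" using class_P unfolding \<E>_def by blast
  qed
  \<comment> \<open>CD is the image of the connected space G x G under (g, h) \<mapsto> g c g^-1 h d
    h^-1.\<close>
  have conn: "connectedin T P"
  proof -
    have "connected_space (prod_topology T T)" using connected by (simp add: connected_space_prod_topology)
    moreover have "continuous_map (prod_topology T T) T
        (\<lambda>z. (fst z \<otimes>\<^bsub>G\<^esub> c \<otimes>\<^bsub>G\<^esub> inv\<^bsub>G\<^esub> (fst z)) \<otimes>\<^bsub>G\<^esub> (snd z \<otimes>\<^bsub>G\<^esub> d \<otimes>\<^bsub>G\<^esub> inv\<^bsub>G\<^esub> (snd z)))"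
      using c(1) d(1) by (intro group_continuous_intros continuous_map_fst continuous_map_snd)
    ultimately have "connectedin T ((\<lambda>z. (fst z \<otimes>\<^bsub>G\<^esub> c \<otimes>\<^bsub>G\<^esub> inv\<^bsub>G\<^esub> (fst z)) \<otimes>\<^bsub>G\<^esub>
        (snd z \<otimes>\<^bsub>G\<^esub> d \<otimes>\<^bsub>G\<^esub> inv\<^bsub>G\<^esub> (snd z))) ` topspace (prod_topology T T))"
      by (rule connectedin_image)
    also have "(\<lambda>z. (fst z \<otimes>\<^bsub>G\<^esub> c \<otimes>\<^bsub>G\<^esub> inv\<^bsub>G\<^esub> (fst z)) \<otimes>\<^bsub>G\<^esub>
        (snd z \<otimes>\<^bsub>G\<^esub> d \<otimes>\<^bsub>G\<^esub> inv\<^bsub>G\<^esub> (snd z))) ` topspace (prod_topology T T) = P"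
    proof (intro subset_antisym subsetI)
      fix z assume "z \<in> P"
      then obtain g h where "g \<in> carrier G" "h \<in> carrier G"
          "z = (g \<otimes>\<^bsub>G\<^esub> c \<otimes>\<^bsub>G\<^esub> inv\<^bsub>G\<^esub> g) \<otimes>\<^bsub>G\<^esub> (h \<otimes>\<^bsub>G\<^esub> d \<otimes>\<^bsub>G\<^esub> inv\<^bsub>G\<^esub> h)"
        unfolding P_def set_mult_def c(2) d(2) conjugacy_class_def by blast
      then show "z \<in> (\<lambda>z. (fst z \<otimes>\<^bsub>G\<^esub> c \<otimes>\<^bsub>G\<^esub> inv\<^bsub>G\<^esub> (fst z)) \<otimes>\<^bsub>G\<^esub>
          (snd z \<otimes>\<^bsub>G\<^esub> d \<otimes>\<^bsub>G\<^esub> inv\<^bsub>G\<^esub> (snd z))) ` topspace (prod_topology T T)"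
        by (intro image_eqI[of _ _ "(g, h)"]) (simp_all add: topspace_carrier)
    next
      fix z assume "z \<in> (\<lambda>z. (fst z \<otimes>\<^bsub>G\<^esub> c \<otimes>\<^bsub>G\<^esub> inv\<^bsub>G\<^esub> (fst z)) \<otimes>\<^bsub>G\<^esub>
          (snd z \<otimes>\<^bsub>G\<^esub> d \<otimes>\<^bsub>G\<^esub> inv\<^bsub>G\<^esub> (snd z))) ` topspace (prod_topology T T)"
      then obtain g h where "g \<in> carrier G" "h \<in> carrier G"
          "z = (g \<otimes>\<^bsub>G\<^esub> c \<otimes>\<^bsub>G\<^esub> inv\<^bsub>G\<^esub> g) \<otimes>\<^bsub>G\<^esub> (h \<otimes>\<^bsub>G\<^esub> d \<otimes>\<^bsub>G\<^esub> inv\<^bsub>G\<^esub> h)"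
        by (auto simp: topspace_carrier)
      then show "z \<in> P"
        unfolding P_def set_mult_def c(2) d(2) conjugacy_class_def by blast
    qed
    finally show ?thesis .
  qed
  have "infinite \<E>"
  proof
    assume fin: "finite \<E>"
    have closed: "closedin T E" if E: "E \<in> \<E>" for E
    proof -
      obtain z where z: "z \<in> carrier G" "E = conjugacy_class G z"
        using E P_carrier unfolding \<E>_def by blast
      then have "compactin T E"
        using compactin_image[OF assms(2) continuous_map_orbit[OF z(1)]]
        by (simp add: conjugacy_class_image topspace_carrier)
      then show ?thesis by (rule compactin_imp_closedin[OF Hausdorff])
    qed
    have cd: "c \<otimes>\<^bsub>G\<^esub> d \<in> P" using PI c d conjugacy_class_self by simp
    define E where "E = conjugacy_class G (c \<otimes>\<^bsub>G\<^esub> d)"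
    have E: "E \<in> \<E>" using cd by (simp add: E_def \<E>_def)
    \<comment> \<open>Classes are compact, hence closed, and there are finitely many, so the union
      \<open>R\<close> of the others is closed too; \<open>E\<close> and \<open>R\<close> would
      separate the connected set \<open>P\<close>.\<close>
    have "P \<subseteq> E"
    proof (rule ccontr)
      assume "\<not> P \<subseteq> E"
      then obtain z where z: "z \<in> P" "z \<notin> E" by blast
      have disj: "E \<inter> \<Union>(\<E> - {E}) = {}"
      proof (rule ccontr)
        assume "E \<inter> \<Union>(\<E> - {E}) \<noteq> {}"
        then obtain w y where w: "w \<in> E" "y \<in> P" "w \<in> conjugacy_class G y" "conjugacy_class G y \<noteq> E"
          by (auto simp: \<E>_def)
        then show False
          using conjugacy_class_eq[of y w] conjugacy_class_eq[of "c \<otimes>\<^bsub>G\<^esub> d" w] P_carrier c(1) d(1)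
          by (auto simp: E_def)
      qed
      define R where "R = \<Union>(\<E> - {E})"
      have PE: "P = E \<union> R" using Union E unfolding R_def by blast
      have "\<exists>E1 E2. closedin T E1 \<and> closedin T E2 \<and> P \<subseteq> E1 \<union> E2 \<and> E1 \<inter> E2 \<inter> P = {} \<and>
          E1 \<inter> P \<noteq> {} \<and> E2 \<inter> P \<noteq> {}"
      proof (intro exI conjI)
        show "closedin T E" using closed E by simp
        show "closedin T R" unfolding R_def using closed fin by (intro closedin_Union) auto
        show "P \<subseteq> E \<union> R" using PE by simp
        show "E \<inter> R \<inter> P = {}" using disj by (simp add: R_def)
        have "c \<otimes>\<^bsub>G\<^esub> d \<in> E" using conjugacy_class_self c(1) d(1) by (simp add: E_def)
        then show "E \<inter> P \<noteq> {}" using cd by blast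
        show "R \<inter> P \<noteq> {}" using z PE by blast
      qed
      then show False using conn[unfolded connectedin_closedin, THEN conjunct2] by (rule notE[rotated])
    qed
    \<comment> \<open>For every pair in C x D, the products (g x g^-1) y and x y lie in the one
      class \<open>E\<close> and are therefore conjugate, as
      \<open>Ad_commute_if_single_class\<close> demands.\<close>
    have "Ad x o\<^sub>L Ad y = Ad y o\<^sub>L Ad x" if x: "x \<in> C" and y: "y \<in> D" for x y
    proof (rule Ad_commute_if_single_class[OF assms(2) C_carrier[OF x] D_carrier[OF y]])
      fix g assume g: "g \<in> carrier G"
      have "conj_by g x \<in> C" using conj_by_in_class g c x by simp
      then have "conj_by g x \<otimes>\<^bsub>G\<^esub> y \<in> E" "x \<otimes>\<^bsub>G\<^esub> y \<in> E" using PI x y \<open>P \<subseteq> E\<close> by blast+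
      then have "conj_by g x \<otimes>\<^bsub>G\<^esub> y \<in> conjugacy_class G (x \<otimes>\<^bsub>G\<^esub> y)"
        using conjugacy_class_eq[of "c \<otimes>\<^bsub>G\<^esub> d" "x \<otimes>\<^bsub>G\<^esub> y"] c(1) d(1) by (simp add: E_def)
      then show "\<exists>h\<in>carrier G. conj_by g x \<otimes>\<^bsub>G\<^esub> y = conj_by h (x \<otimes>\<^bsub>G\<^esub> y)"
        by (auto simp: conjugacy_class_def conjugate_def)
    qed
    then have "c \<in> group_center G"
      unfolding c(2) d(2)
      by (intro central_if_Ad_commutes[OF connected_lie_group_chart_axioms assms(2) c(1) d(1) noncentral(2)])
    then show False using noncentral by simp
  qed
  then show ?thesis
    using classes Union unfolding P_def by (intro exI[of _ \<E>]) simp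
qed

end
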